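(* Let $\mathbb{Q}$ be the countable dense linear order without endpoints. Then $$\mathrm{Aut}(\mathrm{Aut}(\mathbb{Q}))\cong \mathrm{Aut}(\mathbb{Q})\rtimes\mathbb{Z}_2.$$
   Context: $\mathrm{Aut}(\mathbb{Q})$ is the group of order-preserving bijections of $\mathbb{Q}$; $\mathrm{Aut}(\mathrm{Aut}(\mathbb{Q}))$ is the group of all (abstract) group automorphisms of $\mathrm{Aut}(\mathbb{Q})$; $\mathbb{Z}_2$ is the cyclic group of order $2$. *)

theory Defs
  imports "HOL-Algebra.Algebra"
begin

text \<open>
  The order-automorphisms of a linear order form a subgroup of the group of all bijections;
  on a linear order a monotone bijection automatically has a monotone inverse.
  Multiplication is composition of maps. On the carrier \<open>UNIV\<close> the extensionality
  requirement built into \<^const>\<open>Bij\<close> is vacuous.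
\<close>

definition order_Aut :: "('a::linorder \<Rightarrow> 'a) monoid" where
  "order_Aut = BijGroup (UNIV :: 'a set) \<lparr>carrier := {f \<in> Bij UNIV. mono f}\<rparr>"

text \<open>
  The (outer) semidirect product of \<open>N\<close> and \<open>H\<close> with respect to an action
  \<open>\<phi>\<close> of \<open>H\<close> on \<open>N\<close>, meaningful for \<open>\<phi> \<in> hom H (AutoGroup N)\<close>.
\<close>

definition semidirect_product ::
    "('a, 'c) monoid_scheme \<Rightarrow> ('b, 'd) monoid_scheme \<Rightarrow> ('b \<Rightarrow> 'a \<Rightarrow> 'a) \<Rightarrow> ('a \<times> 'b) monoid" where
  "semidirect_product N H \<phi> =
    \<lparr>carrier = carrier N \<times> carrier H,
     monoid.mult = (\<lambda>(n, h) (n', h'). (n \<otimes>\<^bsub>N\<^esub> \<phi> h n', h \<otimes>\<^bsub>H\<^esub> h')),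
     one = (\<one>\<^bsub>N\<^esub>, \<one>\<^bsub>H\<^esub>)\<rparr>"

text \<open>
  The generator of the cyclic group of order 2 acts on the order-automorphisms of the rationals
  by conjugation with the order-reversing involution \<open>x \<mapsto> - x\<close> (which is its own inverse).
\<close>

definition reversal_action :: "int \<Rightarrow> (rat \<Rightarrow> rat) \<Rightarrow> (rat \<Rightarrow> rat)" where
  "reversal_action i =
    (\<lambda>f \<in> carrier order_Aut. if i = 0 then f else uminus \<circ> f \<circ> uminus)"

lemma carrier_order_Aut: "f \<in> carrier order_Aut \<longleftrightarrow> bij f \<and> mono f"
  by (simp add: order_Aut_def Bij_def)

lemma mult_order_Aut:
  assumes "f \<in> carrier order_Aut" "g \<in> carrier order_Aut"
  shows "f \<otimes>\<^bsub>order_Aut\<^esub> g = f \<circ> g"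
  using assms by (auto simp: order_Aut_def BijGroup_def Bij_def compose_def fun_eq_iff)

lemma one_order_Aut: "\<one>\<^bsub>order_Aut\<^esub> = id"
  by (auto simp: order_Aut_def BijGroup_def)

lemma group_order_Aut: "group (order_Aut :: ('a::linorder \<Rightarrow> 'a) monoid)"
proof (rule groupI)
  fix f g h :: "'a \<Rightarrow> 'a"
  assume f: "f \<in> carrier order_Aut" and g: "g \<in> carrier order_Aut"
    and h: "h \<in> carrier order_Aut"
  have comp: "u \<circ> v \<in> carrier order_Aut"
    if "u \<in> carrier order_Aut" "v \<in> carrier order_Aut" for u v :: "'a \<Rightarrow> 'a"
    using that by (auto simp: carrier_order_Aut mono_def intro: bij_comp)
  show "f \<otimes>\<^bsub>order_Aut\<^esub> g \<in> carrier order_Aut"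
    using comp f g by (simp add: mult_order_Aut)
  show "f \<otimes>\<^bsub>order_Aut\<^esub> g \<otimes>\<^bsub>order_Aut\<^esub> h = f \<otimes>\<^bsub>order_Aut\<^esub> (g \<otimes>\<^bsub>order_Aut\<^esub> h)"
    using comp f g h by (simp add: mult_order_Aut comp_assoc)
next
  show one: "\<one>\<^bsub>order_Aut\<^esub> \<in> carrier (order_Aut :: ('a \<Rightarrow> 'a) monoid)"
    by (simp add: one_order_Aut carrier_order_Aut mono_def)
  fix f :: "'a \<Rightarrow> 'a"
  assume f: "f \<in> carrier order_Aut"
  show "\<one>\<^bsub>order_Aut\<^esub> \<otimes>\<^bsub>order_Aut\<^esub> f = f"
    using one f by (simp add: mult_order_Aut) (simp add: one_order_Aut)
  have b: "bij f" and m: "mono f" using f by (auto simp: carrier_order_Aut)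
  have "mono (inv_into UNIV f)"
  proof (rule monoI, rule ccontr)
    fix x y assume "x \<le> y" and "\<not> inv_into UNIV f x \<le> inv_into UNIV f y"
    hence "f (inv_into UNIV f y) \<le> f (inv_into UNIV f x)" by (intro monoD[OF m]) simp
    hence "y \<le> x" using b by (simp add: bij_is_surj surj_f_inv_f)
    with \<open>x \<le> y\<close> have "x = y" by simp
    with \<open>\<not> inv_into UNIV f x \<le> inv_into UNIV f y\<close> show False by simp
  qed
  hence i: "inv_into UNIV f \<in> carrier order_Aut"
    using b by (simp add: carrier_order_Aut bij_imp_bij_inv)
  have "inv_into UNIV f \<otimes>\<^bsub>order_Aut\<^esub> f = \<one>\<^bsub>order_Aut\<^esub>"
    using b f i by (simp add: mult_order_Aut one_order_Aut bij_is_inj)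
  with i show "\<exists>g\<in>carrier order_Aut. g \<otimes>\<^bsub>order_Aut\<^esub> f = \<one>\<^bsub>order_Aut\<^esub>" by blast
qed

lemma group_semidirect_product:
  assumes "group N" "group H" and \<phi>: "\<phi> \<in> hom H (AutoGroup N)"
  shows "group (semidirect_product N H \<phi>)"
proof -
  interpret N: group N by fact
  interpret H: group H by fact
  interpret A: group "AutoGroup N" by (rule N.AutoGroup)
  interpret P: group_hom H "AutoGroup N" \<phi>
    using \<phi> by unfold_locales
  have au: "\<phi> h \<in> auto N" if "h \<in> carrier H" for h
    using P.hom_closed[OF that] by (simp add: AutoGroup_def)
  have cl [simp]: "\<phi> h n \<in> carrier N" if "h \<in> carrier H" "n \<in> carrier N" for h n
    using au[OF that(1)] that(2) by (auto simp: auto_def hom_def)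
  have mu [simp]: "\<phi> h (n \<otimes>\<^bsub>N\<^esub> m) = \<phi> h n \<otimes>\<^bsub>N\<^esub> \<phi> h m"
    if "h \<in> carrier H" "n \<in> carrier N" "m \<in> carrier N" for h n m
    using au[OF that(1)] that(2,3) by (auto simp: auto_def hom_def)
  have ac: "\<phi> (h \<otimes>\<^bsub>H\<^esub> k) n = \<phi> h (\<phi> k n)"
    if "h \<in> carrier H" "k \<in> carrier H" "n \<in> carrier N" for h k n
    using P.hom_mult[OF that(1,2)] au[OF that(1)] au[OF that(2)] that(3)
    by (simp add: AutoGroup_def BijGroup_def auto_def compose_def)
  have o1 [simp]: "\<phi> \<one>\<^bsub>H\<^esub> n = n" if "n \<in> carrier N" for n
    using P.hom_one that by (simp add: AutoGroup_def BijGroup_def)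
  have o2 [simp]: "\<phi> h \<one>\<^bsub>N\<^esub> = \<one>\<^bsub>N\<^esub>" if "h \<in> carrier H" for h
    using mu[of h "\<one>\<^bsub>N\<^esub>" "\<one>\<^bsub>N\<^esub>"] that by simp
  show ?thesis
  proof (rule groupI)
    fix x assume x: "x \<in> carrier (semidirect_product N H \<phi>)"
    obtain n h where xe: "x = (n, h)" by (cases x)
    with x have nh: "n \<in> carrier N" "h \<in> carrier H" by (auto simp: semidirect_product_def)
    let ?y = "(\<phi> (inv\<^bsub>H\<^esub> h) (inv\<^bsub>N\<^esub> n), inv\<^bsub>H\<^esub> h)"
    have "\<phi> (inv\<^bsub>H\<^esub> h) (inv\<^bsub>N\<^esub> n) \<otimes>\<^bsub>N\<^esub> \<phi> (inv\<^bsub>H\<^esub> h) n = \<one>\<^bsub>N\<^esub>"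
      using mu[of "inv\<^bsub>H\<^esub> h" "inv\<^bsub>N\<^esub> n" n] nh by (simp del: P.hom_inv)
    hence "?y \<otimes>\<^bsub>semidirect_product N H \<phi>\<^esub> x = \<one>\<^bsub>semidirect_product N H \<phi>\<^esub>"
      using nh by (simp add: semidirect_product_def xe del: P.hom_inv)
    moreover have "?y \<in> carrier (semidirect_product N H \<phi>)"
      using nh by (simp add: semidirect_product_def del: P.hom_inv)
    ultimately show "\<exists>y\<in>carrier (semidirect_product N H \<phi>).
        y \<otimes>\<^bsub>semidirect_product N H \<phi>\<^esub> x = \<one>\<^bsub>semidirect_product N H \<phi>\<^esub>" by blast
  qed (auto simp: semidirect_product_def N.m_assoc H.m_assoc ac simp del: P.hom_mult P.hom_one)
qed

lemma hom_reversal_action: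
  "reversal_action \<in> hom (integer_mod_group 2) (AutoGroup order_Aut)"
proof -
  have cl: "uminus \<circ> f \<circ> uminus \<in> carrier order_Aut" if "f \<in> carrier order_Aut" for f :: "rat \<Rightarrow> rat"
    using that by (auto simp: carrier_order_Aut mono_def intro!: bij_comp bij_uminus)
  have invol: "uminus \<circ> (uminus \<circ> f \<circ> uminus) \<circ> uminus = f" for f :: "rat \<Rightarrow> rat"
    by (simp add: fun_eq_iff)
  have ca: "reversal_action i f \<in> carrier order_Aut" if "f \<in> carrier order_Aut" for i f
    using that cl by (simp add: reversal_action_def)
  have ra2: "reversal_action i (reversal_action i f) = f" if "f \<in> carrier order_Aut" for i f
    using that cl by (simp add: reversal_action_def invol)
  have "reversal_action i \<in> hom order_Aut order_Aut" for i
  proof (rule homI)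
    fix f g :: "rat \<Rightarrow> rat"
    assume fg: "f \<in> carrier order_Aut" "g \<in> carrier order_Aut"
    have "f \<circ> g \<in> carrier order_Aut"
      using monoid.m_closed[OF group.is_monoid[OF group_order_Aut] fg] fg
      by (simp add: mult_order_Aut)
    with fg show "reversal_action i (f \<otimes>\<^bsub>order_Aut\<^esub> g) =
        reversal_action i f \<otimes>\<^bsub>order_Aut\<^esub> reversal_action i g"
      using ca by (simp add: mult_order_Aut) (simp add: reversal_action_def fun_eq_iff)
  qed (rule ca)
  moreover have "reversal_action i \<in> Bij (carrier order_Aut)" for i
    unfolding Bij_def
    by (auto intro!: bij_betwI[where g = "reversal_action i"] ca ra2)
      (simp add: reversal_action_def)
  ultimately have au: "reversal_action i \<in> auto order_Aut" for i
    by (simp add: auto_def)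
  show ?thesis
  proof (rule homI)
    fix i assume "i \<in> carrier (integer_mod_group 2)"
    show "reversal_action i \<in> carrier (AutoGroup order_Aut)"
      using au by (simp add: AutoGroup_def)
  next
    fix i j :: int
    assume "i \<in> carrier (integer_mod_group 2)" "j \<in> carrier (integer_mod_group 2)"
    hence "i \<in> {0, 1}" "j \<in> {0, 1}" by (auto simp: carrier_integer_mod_group)
    hence "reversal_action ((i + j) mod 2) f =
        compose (carrier order_Aut) (reversal_action i) (reversal_action j) f" for f
      by (cases "f \<in> carrier order_Aut")
        (auto simp: reversal_action_def compose_def cl invol)
    hence "reversal_action ((i + j) mod 2) =
        compose (carrier order_Aut) (reversal_action i) (reversal_action j)"
      by (rule ext)
    thus "reversal_action (i \<otimes>\<^bsub>integer_mod_group 2\<^esub> j) =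
        reversal_action i \<otimes>\<^bsub>AutoGroup order_Aut\<^esub> reversal_action j"
      using au by (simp add: AutoGroup_def BijGroup_def auto_def)
  qed
qed

end

theory Submission
  imports Defs "HOL-Analysis.Continuum_Not_Denumerable"
begin

text \<open>
  The group \<open>G\<close> of order-automorphisms of the rationals has the small index property in the
  following form: a proper subgroup \<open>H\<close> of countable index fixes a rational point. Let \<open>rst S\<close> be
  the group of all elements of \<open>G\<close> that move no point outside \<open>S\<close>. Elements of \<open>rst (S m)\<close> for
  disjoint sets \<open>S m\<close> can be glued, and a diagonal argument over uncountably many gluings shows that
  \<open>H\<close> contains \<open>rst\<close> of an unbounded union of intervals. Squeezing the gaps between
  these intervals in uncountably many ways yields an element of \<open>H\<close> that moves the gaps into the
  intervals; hence \<open>H\<close> contains \<open>rst\<close> of the gaps as well, and then \<open>rst {c<..}\<close> for some \<open>c\<close>.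
  The set of all \<open>b\<close> with \<open>rst {..<b} \<subseteq> H\<close> is therefore an \<open>H\<close>-invariant nonempty lower set; it is
  not everything, and its boundary is not an irrational cut, because the orbit of an irrational cut
  is uncountable.

  Point stabilisers have countable index, so an automorphism of \<open>G\<close> maps them to subgroups fixing
  a point and thus permutes them. It is conjugation by the induced permutation of the rationals,
  which is monotone or antitone because \<open>G\<close> is transitive on pairs \<open>p < q\<close>.
\<close>

section \<open>Order-automorphisms, gluing and countable index\<close>

abbreviation order_auts :: "('a::linorder \<Rightarrow> 'a) set" where
  "order_auts \<equiv> carrier order_Aut"

text \<open>HOL-Algebra reserves \<open>inv\<close> for group inverses.\<close>

abbreviation finv :: "('a \<Rightarrow> 'b) \<Rightarrow> 'b \<Rightarrow> 'a" where
  "finv \<equiv> inv_into UNIV"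

lemma order_autsI:
  assumes "surj f" "\<And>x y. x < y \<Longrightarrow> f x < f y"
  shows "f \<in> order_auts"
proof -
  have "strict_mono f" using assms(2) by (auto simp: strict_mono_def)
  then show ?thesis
    using assms(1) by (auto simp: carrier_order_Aut bij_def strict_mono_mono strict_mono_imp_inj_on)
qed

context
  fixes f :: "'a::linorder \<Rightarrow> 'a"
  assumes f: "f \<in> order_auts"
begin

lemma aut_inv_right [simp]: "f (finv f x) = x"
  using f by (simp add: carrier_order_Aut bij_is_surj surj_f_inv_f)

lemma aut_inv_left [simp]: "finv f (f x) = x"
  using f by (simp add: carrier_order_Aut bij_is_inj)

lemma aut_eq_iff [simp]: "f x = f y \<longleftrightarrow> x = y"
  using f by (auto simp: carrier_order_Aut dest: bij_is_inj injD)

lemma aut_less_iff [simp]: "f x < f y \<longleftrightarrow> x < y"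
proof -
  have "mono f" using f by (simp add: carrier_order_Aut)
  then show ?thesis using monoD[of f x y] monoD[of f y x] aut_eq_iff[of x y]
    by (cases x y rule: linorder_cases) (auto simp: less_le)
qed

lemma aut_le_iff [simp]: "f x \<le> f y \<longleftrightarrow> x \<le> y"
  using aut_less_iff by (meson not_le)

lemma aut_inv_comp [simp]: "finv f \<circ> f = id" "f \<circ> finv f = id"
  by (auto simp: fun_eq_iff)

lemma aut_inv_eq_iff: "finv f x = y \<longleftrightarrow> x = f y"
  by (metis aut_inv_left aut_inv_right)

lemma aut_bij: "bij f" using f by (simp add: carrier_order_Aut)

lemma aut_inv [simp, intro]: "finv f \<in> order_auts"
proof (rule order_autsI)
  show "surj (finv f)" by (metis aut_bij bij_imp_bij_inv bij_is_surj)
  show "finv f x < finv f y" if "x < y" for x y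
    using that by (metis aut_inv_right aut_less_iff)
qed

lemma aut_inv_inv [simp]: "finv (finv f) = f"
  using aut_bij by (rule inv_inv_eq)

end

lemma aut_comp [simp, intro]: "f \<circ> g \<in> order_auts"
  if "f \<in> order_auts" "g \<in> order_auts" for f g :: "'a::linorder \<Rightarrow> 'a"
  using that by (auto simp: carrier_order_Aut mono_def intro: bij_comp)

lemma aut_id [simp, intro]: "id \<in> order_auts"
  by (auto simp: carrier_order_Aut mono_def)

lemma aut_inv_comp_distrib:
  "f \<in> order_auts \<Longrightarrow> g \<in> order_auts \<Longrightarrow> finv (f \<circ> g) = finv g \<circ> finv f"
  by (simp add: aut_bij o_inv_distrib)

lemma aut_funpow [simp, intro]: "f \<in> order_auts \<Longrightarrow> (f ^^ n) \<in> order_auts"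
  by (induction n) auto

section \<open>Rigid stabilisers and gluing\<close>

definition rst :: "'a::linorder set \<Rightarrow> ('a \<Rightarrow> 'a) set" where
  "rst S = {f \<in> order_auts. \<forall>x. x \<notin> S \<longrightarrow> f x = x}"

lemma rstD: "f \<in> rst S \<Longrightarrow> f \<in> order_auts" "f \<in> rst S \<Longrightarrow> x \<notin> S \<Longrightarrow> f x = x"
  by (auto simp: rst_def)

lemma rstI: "f \<in> order_auts \<Longrightarrow> (\<And>x. x \<notin> S \<Longrightarrow> f x = x) \<Longrightarrow> f \<in> rst S"
  by (auto simp: rst_def)

lemma rst_mono: "S \<subseteq> Y \<Longrightarrow> rst S \<subseteq> rst Y"
  by (auto simp: rst_def)

lemma rst_inv: "f \<in> rst S \<Longrightarrow> finv f \<in> rst S"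
  by (auto simp: rst_def aut_inv_eq_iff)

lemma rst_comp: "f \<in> rst S \<Longrightarrow> g \<in> rst S \<Longrightarrow> f \<circ> g \<in> rst S"
  by (auto simp: rst_def)

lemma rst_mem_iff [simp]: "f \<in> rst S \<Longrightarrow> f x \<in> S \<longleftrightarrow> x \<in> S"
  by (metis aut_eq_iff rstD)

lemma rst_conj:
  assumes "f \<in> rst S" "u \<in> order_auts" "\<And>x. x \<in> S \<Longrightarrow> u x \<in> Y"
  shows "u \<circ> f \<circ> finv u \<in> rst Y"
proof (rule rstI)
  show "u \<circ> f \<circ> finv u \<in> order_auts" using assms rstD by blast
  fix x assume "x \<notin> Y"
  then have "finv u x \<notin> S" using assms(2,3) by fastforce
  then show "(u \<circ> f \<circ> finv u) x = x" using assms(1,2) by (simp add: rstD(2))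
qed

text \<open>The index is picked by \<open>SOME\<close>; for disjoint families it is the only
  candidate.\<close>

definition glue :: "('i \<Rightarrow> 'a set) \<Rightarrow> ('i \<Rightarrow> 'a \<Rightarrow> 'a) \<Rightarrow> 'a \<Rightarrow> 'a" where
  "glue S g x = (if \<exists>m. x \<in> S m then g (SOME m. x \<in> S m) x else x)"

lemma glue_off: "(\<And>m. x \<notin> S m) \<Longrightarrow> glue S g x = x"
  by (simp add: glue_def)

lemma glue_on:
  assumes "disjoint_family S" "x \<in> S m"
  shows "glue S g x = g m x"
proof -
  have "(SOME m. x \<in> S m) = m"
    using assms by (intro some_equality) (auto simp: disjoint_family_on_def)
  then show ?thesis using assms(2) by (auto simp: glue_def)
qed

text \<open>The sets may interleave arbitrarily. Two points meet at most two of them, so at these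
  points the glued map agrees with a single automorphism. Gluing the inverses gives
  surjectivity.\<close>

lemma glue_rst:
  fixes S :: "'i \<Rightarrow> 'a::linorder set"
  assumes S: "disjoint_family S" and g: "\<And>m. g m \<in> rst (S m)"
  shows "glue S g \<in> rst (\<Union>m. S m)"
proof (rule rstI)
  let ?h = "glue S g"
  have ex: "x \<in> S m \<Longrightarrow> y \<in> S m \<Longrightarrow> ?h x = g m x \<and> ?h y = g m y" for x y m
    by (simp add: glue_on[OF S])
  show "?h \<in> order_auts"
  proof (rule order_autsI)
    show "surj ?h"
    proof (rule surjI)
      fix x
      show "?h (glue S (\<lambda>m. finv (g m)) x) = x"
      proof (cases "\<exists>m. x \<in> S m")
        case True
        then obtain m where m: "x \<in> S m" by blast
        then have "finv (g m) x \<in> S m" using rst_inv[OF g] by simp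
        then show ?thesis using m rstD(1)[OF g] by (simp add: glue_on[OF S])
      qed (simp add: glue_off)
    qed
    fix x y :: 'a assume xy: "x < y"
    \<comment> \<open>With \<open>x \<in> S m\<close> and \<open>y \<in> S n\<close> for \<open>m \<noteq> n\<close>, the map \<open>glue S g\<close> agrees with
      \<open>g m \<circ> g n\<close> at both points.\<close>
    have "\<exists>u \<in> order_auts. ?h x = u x \<and> ?h y = u y"
    proof (cases "\<exists>m. x \<in> S m")
      case True
      then obtain m where m: "x \<in> S m" by blast
      show ?thesis
      proof (cases "\<exists>n. y \<in> S n")
        case True
        then obtain n where n: "y \<in> S n" by blast
        show ?thesis
        proof (cases "m = n")
          case True
          then show ?thesis using ex[of x m y] m n rstD(1)[OF g[of m]] by blast
        next
          case False
          then have "x \<notin> S n" "g n y \<notin> S m"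
            using m n S g[of n] by (auto simp: disjoint_family_on_def)
              (metis disjoint_iff rst_mem_iff)
          then have "(g m \<circ> g n) x = g m x" "(g m \<circ> g n) y = g n y"
            using rstD(2)[OF g] by simp_all
          then show ?thesis using rstD(1)[OF g]
            by (intro bexI[of _ "g m \<circ> g n"])
              (auto simp del: comp_apply simp: glue_on[OF S m] glue_on[OF S n])
        qed
      next
        case False
        then have "?h y = g m y" using rstD(2)[OF g] by (simp add: glue_off)
        then show ?thesis using m rstD(1)[OF g[of m]] by (auto simp: glue_on[OF S])
      qed
    next
      case nx: False
      show ?thesis
      proof (cases "\<exists>n. y \<in> S n")
        case True
        then obtain n where n: "y \<in> S n" by blast
        have "?h x = g n x" using nx rstD(2)[OF g] by (simp add: glue_off)
        then show ?thesis using n rstD(1)[OF g[of n]] by (auto simp: glue_on[OF S])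
      next
        case False
        then show ?thesis using nx by (intro bexI[of _ id]) (auto simp: glue_off)
      qed
    qed
    then show "?h x < ?h y" using xy by force
  qed
qed (simp add: glue_off)

text \<open>Cutting \<open>f\<close> off outside an invariant \<open>S\<close> stays monotone
  because, by \<open>sep\<close>, no point of \<open>S\<close> is carried across a point outside
  it.\<close>

lemma restrict_rst:
  fixes f :: "'a::linorder \<Rightarrow> 'a"
  assumes f: "f \<in> order_auts" and S: "\<And>x. f x \<in> S \<longleftrightarrow> x \<in> S"
    and sep: "\<And>x y. x \<in> S \<Longrightarrow> y \<notin> S \<Longrightarrow> f x < y \<longleftrightarrow> x < y"
  shows "(\<lambda>x. if x \<in> S then f x else x) \<in> rst S"
proof (rule rstI[OF order_autsI])
  let ?g = "\<lambda>x. if x \<in> S then f x else x"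
  have S': "x \<in> S \<Longrightarrow> finv f x \<in> S" for x using S[of "finv f x"] f by simp
  show "surj ?g"
    by (rule surjI[of _ "\<lambda>x. if x \<in> S then finv f x else x"]) (use f S' in auto)
  fix x y :: 'a assume xy: "x < y"
  have "x < f y" if "x \<notin> S" "y \<in> S"
    using sep[OF that(2,1)] S[of y] xy that by (metis linorder_less_linear order_less_asym)
  then show "?g x < ?g y" using xy f sep by auto
qed auto

text \<open>Countable index is witnessed by a colouring of the group by natural numbers whose colour
  classes lie in single left cosets of \<open>H\<close>.\<close>

definition small_index :: "('a::linorder \<Rightarrow> 'a) set \<Rightarrow> bool" where
  "small_index H \<longleftrightarrow> H \<subseteq> order_auts \<and> (\<forall>f\<in>H. \<forall>g\<in>H. f \<circ> g \<in> H) \<and> (\<forall>f\<in>H. finv f \<in> H) \<and>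
    (\<exists>c :: ('a \<Rightarrow> 'a) \<Rightarrow> nat. \<forall>f\<in>order_auts. \<forall>g\<in>order_auts. c f = c g \<longrightarrow> finv f \<circ> g \<in> H)"

lemma small_indexD:
  assumes "small_index H"
  shows "f \<in> H \<Longrightarrow> f \<in> order_auts" "f \<in> H \<Longrightarrow> g \<in> H \<Longrightarrow> f \<circ> g \<in> H" "f \<in> H \<Longrightarrow> finv f \<in> H"
  using assms by (auto simp: small_index_def)

lemma small_index_pigeonhole:
  assumes H: "small_index H" and A: "uncountable A" and g: "\<And>s. s \<in> A \<Longrightarrow> g s \<in> order_auts"
  obtains s t where "s \<in> A" "t \<in> A" "s \<noteq> t" "finv (g s) \<circ> g t \<in> H"
proof -
  obtain c :: "_ \<Rightarrow> nat"
    where c: "\<And>u v. u \<in> order_auts \<Longrightarrow> v \<in> order_auts \<Longrightarrow> c u = c v \<Longrightarrow> finv u \<circ> v \<in> H"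
    using H unfolding small_index_def by metis
  have "\<not> inj_on (\<lambda>s. c (g s)) A" using A countableI by blast
  then obtain s t where "s \<in> A" "t \<in> A" "s \<noteq> t" "c (g s) = c (g t)" by (auto simp: inj_on_def)
  then show thesis using that c g by metis
qed

lemma uncountable_nat_sets: "uncountable (UNIV :: nat set set)"
proof
  assume "countable (UNIV :: nat set set)"
  then obtain f :: "nat \<Rightarrow> nat set" where "range f = UNIV"
    by (metis uncountable_def UNIV_not_empty)
  then show False using Cantors_theorem[of UNIV] by (metis Pow_UNIV)
qed

text \<open>The conjugator only has to normalise the group, so that the order-reversing
  \<open>uminus\<close> is covered too. The colouring is transported along the conjugation.\<close>

lemma small_index_conj:
  fixes u :: "'a::linorder \<Rightarrow> 'a"
  assumes H: "small_index H" and u: "bij u"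
    and n: "\<And>f. f \<in> order_auts \<Longrightarrow> u \<circ> f \<circ> finv u \<in> order_auts"
    and n': "\<And>f. f \<in> order_auts \<Longrightarrow> finv u \<circ> f \<circ> u \<in> order_auts"
  shows "small_index {f. u \<circ> f \<circ> finv u \<in> H}"
proof -
  obtain c :: "_ \<Rightarrow> nat"
    where c: "\<And>f g. f \<in> order_auts \<Longrightarrow> g \<in> order_auts \<Longrightarrow> c f = c g \<Longrightarrow> finv f \<circ> g \<in> H"
    using H unfolding small_index_def by metis
  have [simp]: "u (finv u x) = x" "finv u (u x) = x" for x
    using u by (auto simp: bij_is_surj surj_f_inv_f bij_is_inj)
  have comp: "u \<circ> (f \<circ> g) \<circ> finv u = (u \<circ> f \<circ> finv u) \<circ> (u \<circ> g \<circ> finv u)" for f g :: "'a \<Rightarrow> 'a"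
    by (simp add: fun_eq_iff)
  have inveq: "u \<circ> finv f \<circ> finv u = finv (u \<circ> f \<circ> finv u)" if "f \<in> order_auts" for f
    using that u by (simp add: o_inv_distrib bij_comp aut_bij bij_imp_bij_inv inv_inv_eq comp_assoc)
  have sub: "f \<in> order_auts" if "u \<circ> f \<circ> finv u \<in> H" for f
  proof -
    have "finv u \<circ> (u \<circ> f \<circ> finv u) \<circ> u \<in> order_auts"
      by (rule n') (use that small_indexD(1)[OF H] in blast)
    moreover have "finv u \<circ> (u \<circ> f \<circ> finv u) \<circ> u = f" by (simp add: fun_eq_iff)
    ultimately show ?thesis by simp
  qed
  show ?thesis unfolding small_index_def
  proof (intro conjI ballI exI[of _ "\<lambda>f. c (u \<circ> f \<circ> finv u)"] impI)
    show "{f. u \<circ> f \<circ> finv u \<in> H} \<subseteq> order_auts" using sub by blast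
    show "f \<circ> g \<in> {f. u \<circ> f \<circ> finv u \<in> H}"
      if "f \<in> {f. u \<circ> f \<circ> finv u \<in> H}" "g \<in> {f. u \<circ> f \<circ> finv u \<in> H}" for f g
      using that small_indexD(2)[OF H] by (simp only: mem_Collect_eq comp)
    show "finv f \<in> {f. u \<circ> f \<circ> finv u \<in> H}" if "f \<in> {f. u \<circ> f \<circ> finv u \<in> H}" for f
      using that small_indexD(3)[OF H] inveq sub by auto
    show "finv f \<circ> g \<in> {f. u \<circ> f \<circ> finv u \<in> H}"
      if "f \<in> order_auts" "g \<in> order_auts" "c (u \<circ> f \<circ> finv u) = c (u \<circ> g \<circ> finv u)" for f g
      using c[OF n n] that inveq by (simp only: mem_Collect_eq comp)
  qed
qed

lemma small_index_conj_aut: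
  "small_index H \<Longrightarrow> u \<in> order_auts \<Longrightarrow> small_index {f. u \<circ> f \<circ> finv u \<in> H}"
  by (rule small_index_conj) (auto intro: aut_bij)

lemma small_index_conjD:
  assumes "u \<in> order_auts" "finv u \<circ> f \<circ> u \<in> {f. u \<circ> f \<circ> finv u \<in> H}"
  shows "f \<in> H"
proof -
  have "u \<circ> (finv u \<circ> f \<circ> u) \<circ> finv u = f" using assms(1) by (simp add: fun_eq_iff)
  then show ?thesis using assms(2) by simp
qed

text \<open>A diagonal argument: otherwise gluing bad elements \<open>y m\<close> over the subsets of the index
  set yields uncountably many cosets.\<close>

lemma small_index_projection:
  fixes S :: "nat \<Rightarrow> 'a::linorder set"
  assumes H: "small_index H" and S: "disjoint_family S"
  obtains m where "\<And>y. y \<in> rst (S m) \<Longrightarrow> \<exists>h \<in> H \<inter> rst (\<Union>m. S m). \<forall>x \<in> S m. h x = y x"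
proof (rule ccontr)
  assume "\<not> thesis"
  then have "\<forall>m. \<exists>y. y \<in> rst (S m) \<and> \<not> (\<exists>h \<in> H \<inter> rst (\<Union>m. S m). \<forall>x \<in> S m. h x = y x)"
    using that by metis
  then obtain y where y: "\<And>m. y m \<in> rst (S m)"
    and bad: "\<And>m h. h \<in> H \<inter> rst (\<Union>m. S m) \<Longrightarrow> \<exists>x \<in> S m. h x \<noteq> y m x"
    by metis
  define g where "g W = glue S (\<lambda>m. if m \<in> W then y m else id)" for W
  have g: "g W \<in> rst (\<Union>m. S m)" for W
    unfolding g_def using S y by (intro glue_rst) (auto simp: rst_def)
  \<comment> \<open>On \<open>S m\<close> the map \<open>g V\<close> acts as \<open>y m\<close> and
    \<open>g W\<close> as the identity, so membership in \<open>H\<close> would contradict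
    \<open>bad\<close>.\<close>
  have no: "finv (g W) \<circ> g V \<notin> H" if "m \<in> V" "m \<notin> W" for V W m
  proof
    assume "finv (g W) \<circ> g V \<in> H"
    then obtain x where x: "x \<in> S m" "(finv (g W) \<circ> g V) x \<noteq> y m x"
      using bad[of "finv (g W) \<circ> g V" m] g rst_inv rst_comp by blast
    have yx: "y m x \<in> S m" using x(1) y by simp
    have "g W (y m x) = y m x" "g V x = y m x"
      using that glue_on[OF S yx] glue_on[OF S x(1)] by (simp_all add: g_def)
    then show False using x(2) rstD(1)[OF g[of W]] by (simp add: aut_inv_eq_iff)
  qed
  obtain V W where "V \<noteq> W" and h: "finv (g W) \<circ> g V \<in> H"
    using small_index_pigeonhole[OF H uncountable_nat_sets, of g] rstD(1)[OF g] by metis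
  \<comment> \<open>The two sets may differ only by an element of \<open>W\<close>; inverting
    exchanges their roles.\<close>
  have "finv (finv (g W) \<circ> g V) = finv (g V) \<circ> g W"
    using rstD(1)[OF g] by (simp add: aut_inv_comp_distrib)
  then have "finv (g V) \<circ> g W \<in> H" using small_indexD(3)[OF H h] by simp
  then show False using no h \<open>V \<noteq> W\<close> by blast
qed

text \<open>By the projection lemma, \<open>H \<inter> rst U\<close> is normalised by \<open>rst U\<close> for a suitable union \<open>U\<close> of
  infinitely many \<open>S n\<close>, and \<open>H \<inter> rst U\<close> projects onto one of these \<open>rst (S n)\<close>.\<close>

lemma small_index_commutators:
  fixes S :: "nat \<Rightarrow> 'a::linorder set"
  assumes H: "small_index H" and S: "disjoint_family S"
  obtains n where "\<And>u v. u \<in> rst (S n) \<Longrightarrow> v \<in> rst (S n) \<Longrightarrow> u \<circ> v \<circ> finv u \<circ> finv v \<in> H"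
proof -
  \<comment> \<open>The pairing function splits the family into infinitely many rows
    \<open>Z m\<close>, each again an infinite family.\<close>
  define Z where "Z m k = S (prod_encode (m, k))" for m k
  have Z: "disjoint_family (Z m)" for m
    using S by (auto simp: Z_def disjoint_family_on_def)
  have Z': "disjoint_family (\<lambda>m. \<Union>k. Z m k)"
    unfolding disjoint_family_on_def Z_def
  proof (intro ballI impI equals0I)
    fix i j x assume "i \<noteq> j"
      "x \<in> (\<Union>k. S (prod_encode (i, k))) \<inter> (\<Union>k. S (prod_encode (j, k)))"
    then obtain k l where x: "x \<in> S (prod_encode (i, k))" "x \<in> S (prod_encode (j, l))" by blast
    have "prod_encode (i, k) \<noteq> prod_encode (j, l)" using \<open>i \<noteq> j\<close> by simp
    then show False using S x unfolding disjoint_family_on_def by blast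
  qed
  \<comment> \<open>The projection lemma is applied first to the unions of the rows, then inside the
    row found, so that the second witness is supported in that row.\<close>
  obtain m where
    m: "\<And>y. y \<in> rst (\<Union>k. Z m k) \<Longrightarrow>
      \<exists>h \<in> H \<inter> rst (\<Union>m k. Z m k). \<forall>x \<in> (\<Union>k. Z m k). h x = y x"
    by (rule small_index_projection[OF H Z']) (rule that)
  obtain k where
    k: "\<And>y. y \<in> rst (Z m k) \<Longrightarrow> \<exists>h \<in> H \<inter> rst (\<Union>k. Z m k). \<forall>x \<in> Z m k. h x = y x"
    by (rule small_index_projection[OF H Z[of m]]) (rule that)
  \<comment> \<open>A conjugate of \<open>g \<in> rst A\<close> depends only on the values of the
    conjugator on \<open>A\<close>.\<close>
  have agree: "f \<circ> g \<circ> finv f = f' \<circ> g \<circ> finv f'"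
    if "g \<in> rst A" "f \<in> order_auts" "f' \<in> rst A" "\<forall>x\<in>A. f x = f' x" for f f' g and A :: "'a set"
  proof
    fix x
    have f': "f' \<in> order_auts" "g \<in> order_auts" using that rstD(1) by auto
    show "(f \<circ> g \<circ> finv f) x = (f' \<circ> g \<circ> finv f') x"
    proof (cases "x \<in> A")
      case True
      then have *: "finv f' x \<in> A" using rst_inv[OF that(3)] by simp
      then have "finv f x = finv f' x" using that(2,4) f' by (simp add: aut_inv_eq_iff)
      moreover have "g (finv f' x) \<in> A" using * that(1) by simp
      ultimately show ?thesis using that(4) by simp
    next
      case False
      have "finv f x \<notin> A"
      proof
        assume "finv f x \<in> A"
        then have "f' (finv f x) = x" "f' (finv f x) \<in> A" using that by (metis aut_inv_right, simp)
        then show False using False by simp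
      qed
      moreover have "finv f' x \<notin> A" using False rst_inv[OF that(3)] by simp
      ultimately show ?thesis using that(1,2) f' by (simp add: rstD(2))
    qed
  qed
  show thesis
  proof (rule that[of "prod_encode (m, k)"])
    fix u v assume uv: "u \<in> rst (S (prod_encode (m, k)))" "v \<in> rst (S (prod_encode (m, k)))"
    then have uv: "u \<in> rst (Z m k)" "v \<in> rst (Z m k)" by (simp_all add: Z_def)
    have auts: "u \<in> order_auts" "v \<in> order_auts" using uv rstD(1) by auto
    have sub: "rst (Z m k) \<subseteq> rst (\<Union>k. Z m k)" by (rule rst_mono) blast
    obtain h where h: "h \<in> H" "h \<in> rst (\<Union>k. Z m k)" "\<forall>x \<in> Z m k. h x = u x"
      using k[OF uv(1)] by blast
    have ha: "h \<in> order_auts" using small_indexD(1)[OF H h(1)] .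
    obtain w where w: "w \<in> H" "\<forall>x \<in> (\<Union>k. Z m k). w x = v x"
      using m[of v] uv(2) sub by blast
    \<comment> \<open>The commutator of \<open>u\<close> and \<open>v\<close> equals that of
      \<open>h\<close> and \<open>w\<close>: \<open>h\<close> is supported in the row, where
      \<open>w\<close> agrees with \<open>v\<close>, and \<open>v\<close> is supported in
      \<open>Z m k\<close>, where \<open>h\<close> agrees with \<open>u\<close>.\<close>
    have "w \<circ> finv h \<circ> finv w = v \<circ> finv h \<circ> finv v"
      by (rule agree[OF rst_inv[OF h(2)]]) (use w H small_indexD(1) uv sub in blast)+
    then have "v \<circ> finv h \<circ> finv v \<in> H" by (metis w(1) h(1) small_indexD(2,3)[OF H])
    then have "h \<circ> (v \<circ> finv h \<circ> finv v) \<in> H" using h(1) small_indexD(2)[OF H] by blast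
    moreover have "h \<circ> v \<circ> finv h = u \<circ> v \<circ> finv u"
      by (rule agree[OF uv(2) ha uv(1) h(3)])
    then have "h \<circ> (v \<circ> finv h \<circ> finv v) = u \<circ> v \<circ> finv u \<circ> finv v"
      by (metis comp_assoc)
    ultimately show "u \<circ> v \<circ> finv u \<circ> finv v \<in> H" by simp
  qed
qed

text \<open>The infinite-product trick: \<open>g = [h, t]\<close> for \<open>h = g \<circ> g\<^sup>t \<circ> g\<^sup>t\<^sup>t \<circ> \<dots>\<close>, where
  \<open>g\<^sup>t = t \<circ> g \<circ> finv t\<close>.\<close>

lemma rst_commutator:
  assumes t: "t \<in> rst S" and Z: "Y \<subseteq> Z" "Z \<subseteq> S" "\<And>x. x \<in> Z \<Longrightarrow> t x \<in> Z - Y" and g: "g \<in> rst Y"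
  obtains h where "h \<in> rst S" "g = h \<circ> t \<circ> finv h \<circ> finv t"
proof -
  \<comment> \<open>The images of \<open>Y\<close> under powers of \<open>t\<close> are disjoint
    because \<open>t\<close> pushes \<open>Z\<close> into \<open>Z - Y\<close>; \<open>h\<close>
    performs a copy of \<open>g\<close> on each of them.\<close>
  define W where "W n = (t ^^ n) ` Y" for n
  define h where "h = glue W (\<lambda>n. (t ^^ n) \<circ> g \<circ> finv (t ^^ n))"
  have ta: "t \<in> order_auts" and ga: "g \<in> order_auts" using t g rstD(1) by auto
  have pz: "(t ^^ n) x \<in> Z" if "x \<in> Z" for n x
    using that by (induction n) (use Z in auto)
  have "W i \<inter> W j = {}" if "i < j" for i j
  proof -
    have "(t ^^ i) y \<noteq> (t ^^ j) z" if yz: "y \<in> Y" "z \<in> Y" for y z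
    proof
      assume "(t ^^ i) y = (t ^^ j) z"
      also have "(t ^^ j) z = (t ^^ i) ((t ^^ (j - i)) z)"
        using \<open>i < j\<close> by (metis add_diff_inverse_nat comp_apply funpow_add not_less_iff_gr_or_eq)
      finally have "y = (t ^^ (j - i)) z" using ta by simp
      also have "\<dots> = t ((t ^^ (j - i - 1)) z)"
        using \<open>i < j\<close> by (metis Suc_diff_1 comp_apply funpow.simps(2) zero_less_diff)
      finally show False using Z pz yz by blast
    qed
    then show ?thesis by (auto simp: W_def)
  qed
  then have W: "disjoint_family W"
    unfolding disjoint_family_on_def by (metis Int_commute linorder_neqE_nat)
  have WX: "(\<Union>n. W n) \<subseteq> S" using pz Z by (auto simp: W_def)
  have "h \<in> rst (\<Union>n. W n)"
    unfolding h_def by (rule glue_rst[OF W]) (rule rst_conj[OF g], use ta in \<open>auto simp: W_def\<close>)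
  then have h: "h \<in> rst S" using rst_mono[OF WX] by blast
  have ha: "h \<in> order_auts" using h rstD(1) by auto
  have hW: "h ((t ^^ n) y) = (t ^^ n) (g y)" if "y \<in> Y" for n y
    using glue_on[OF W, of "(t ^^ n) y" n] that ta by (auto simp: h_def W_def)
  \<comment> \<open>The commutator identity with the inverses cleared: \<open>t\<close> shifts the
    copy of \<open>g\<close> on \<open>W n\<close> to \<open>W (Suc n)\<close>, and the extra
    \<open>g\<close> supplies the copy on \<open>W 0\<close>.\<close>
  have "h (t x) = g (t (h x))" for x
  proof (cases "\<exists>n. x \<in> W n")
    case True
    then obtain n y where y: "x = (t ^^ n) y" "y \<in> Y" by (auto simp: W_def)
    have "g y \<in> Y" using g y(2) by simp
    then have "(t ^^ n) (g y) \<in> Z" using pz Z by blast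
    then have "g (t ((t ^^ n) (g y))) = t ((t ^^ n) (g y))" using Z rstD(2)[OF g] by blast
    then show ?thesis using hW[OF y(2), of n] hW[OF y(2), of "Suc n"] y(1) by simp
  next
    case False
    then have hx: "h x = x" by (simp add: h_def glue_off)
    show ?thesis
    proof (cases "t x \<in> Y")
      case True
      then show ?thesis using hW[of "t x" 0] hx by simp
    next
      case no: False
      have "t x \<notin> W n" for n
      proof (cases n)
        case 0
        then show ?thesis using no by (simp add: W_def)
      next
        case (Suc k)
        show ?thesis
        proof
          assume "t x \<in> W n"
          then have "x \<in> W k" using Suc ta by (auto simp: W_def)
          then show False using False by blast
        qed
      qed
      then have "h (t x) = t x" by (simp add: h_def glue_off)
      then show ?thesis using hx no rstD(2)[OF g] by simp
    qed
  qed
  note key = this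
  have "g x = (h \<circ> t \<circ> finv h \<circ> finv t) x" for x
    using key[of "finv h (finv t x)"] ha ta by simp
  then show thesis using that[OF h] by blast
qed

section \<open>Piecewise linear automorphisms of the rationals\<close>

text \<open>Linear interpolation through the points \<open>(n, a n)\<close>, continued to the left
  with slope 1. The left part depends on \<open>a 0\<close> alone, which
  \<open>ladder_transport\<close> exploits.\<close>

definition pl :: "(nat \<Rightarrow> rat) \<Rightarrow> rat \<Rightarrow> rat" where
  "pl a x = (if x < 0 then a 0 + x
    else a (nat \<lfloor>x\<rfloor>) + (x - of_nat (nat \<lfloor>x\<rfloor>)) * (a (Suc (nat \<lfloor>x\<rfloor>)) - a (nat \<lfloor>x\<rfloor>)))"

lemma nat_floor_rat: "0 \<le> (x::rat) \<Longrightarrow> of_nat (nat \<lfloor>x\<rfloor>) \<le> x" "(x::rat) < of_nat (nat \<lfloor>x\<rfloor>) + 1"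
  by (linarith)+

lemma pl_of_nat [simp]: "pl a (of_nat n) = a n"
  by (simp add: pl_def)

lemma pl_neg: "x < 0 \<Longrightarrow> pl a x = a 0 + x"
  by (simp add: pl_def)

lemma pl_less_Suc:
  assumes "strict_mono a"
  shows "pl a x < a (Suc (nat \<lfloor>x\<rfloor>))"
proof (cases "x < 0")
  case True
  then show ?thesis using strict_monoD[OF assms, of 0 1] by (simp add: pl_def)
next
  case False
  let ?n = "nat \<lfloor>x\<rfloor>"
  have d: "0 < a (Suc ?n) - a ?n" using strict_monoD[OF assms, of ?n "Suc ?n"] by simp
  have "x - of_nat ?n < 1" using nat_floor_rat(2)[of x] by simp
  then have "(x - of_nat ?n) * (a (Suc ?n) - a ?n) < 1 * (a (Suc ?n) - a ?n)"
    using d by (rule mult_strict_right_mono)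
  then show ?thesis using False by (simp add: pl_def)
qed

lemma pl_ge:
  assumes "strict_mono a" "0 \<le> x"
  shows "a (nat \<lfloor>x\<rfloor>) \<le> pl a x"
  using assms nat_floor_rat(1)[of x] strict_monoD[OF assms(1), of "nat \<lfloor>x\<rfloor>" "Suc (nat \<lfloor>x\<rfloor>)"]
  by (simp add: pl_def)

lemma pl_less:
  assumes a: "strict_mono a" and xy: "x < y"
  shows "pl a x < pl a y"
proof (cases "x < 0")
  case True
  show ?thesis
  proof (cases "y < 0")
    case False
    have "pl a x < a 0" using True by (simp add: pl_def)
    also have "\<dots> \<le> a (nat \<lfloor>y\<rfloor>)" using a by (simp add: strict_mono_less_eq)
    also have "\<dots> \<le> pl a y" using pl_ge[OF a] False by simp
    finally show ?thesis .
  qed (use True xy in \<open>simp add: pl_def\<close>)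
next
  case False
  let ?n = "nat \<lfloor>x\<rfloor>" and ?m = "nat \<lfloor>y\<rfloor>"
  have y: "0 \<le> y" using False xy by simp
  have "?n \<le> ?m" using xy by (intro nat_mono floor_mono) simp
  then consider "?n = ?m" | "Suc ?n \<le> ?m" by linarith
  then show ?thesis
  proof cases
    case 1
    have "0 < a (Suc ?n) - a ?n" using strict_monoD[OF a, of ?n "Suc ?n"] by simp
    then have "(x - of_nat ?n) * (a (Suc ?n) - a ?n) < (y - of_nat ?n) * (a (Suc ?n) - a ?n)"
      using xy by (intro mult_strict_right_mono) auto
    then show ?thesis using False y 1 by (simp add: pl_def)
  next
    case 2
    have "pl a x < a (Suc ?n)" by (rule pl_less_Suc[OF a])
    also have "\<dots> \<le> a ?m" using a 2 by (simp add: strict_mono_less_eq)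
    also have "\<dots> \<le> pl a y" using pl_ge[OF a y] .
    finally show ?thesis .
  qed
qed

text \<open>For unbounded \<open>a\<close> this is surjectivity. A bounded \<open>a\<close> later
  identifies the lower half of an irrational cut with the rationals.\<close>

lemma range_pl:
  assumes a: "strict_mono a"
  shows "range (pl a) = {y. \<exists>n. y < a n}"
proof (intro equalityI subsetI)
  fix y assume "y \<in> {y. \<exists>n. y < a n}"
  then have ex: "\<exists>n. y < a n" by simp
  show "y \<in> range (pl a)"
  proof (cases "y < a 0")
    case True
    then have "y = pl a (y - a 0)" by (simp add: pl_def)
    then show ?thesis by blast
  next
    case False
    \<comment> \<open>The least term above \<open>y\<close> determines the linear piece whose image
      contains \<open>y\<close>.\<close>
    define n where "n = (LEAST n. y < a n)"
    have n: "y < a n" unfolding n_def using ex by (rule LeastI_ex)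
    then obtain m where m: "n = Suc m" using False by (cases n) auto
    then have l: "a m \<le> y" using not_less_Least[of m "\<lambda>n. y < a n"] n_def by auto
    define r where "r = (y - a m) / (a (Suc m) - a m)"
    have r: "0 \<le> r" "r < 1" "r * (a (Suc m) - a m) = y - a m"
      using l n m by (auto simp: r_def)
    then have "\<lfloor>of_nat m + r\<rfloor> = int m" by linarith
    then have "pl a (of_nat m + r) = y" using r by (simp add: pl_def)
    then show ?thesis by blast
  qed
qed (use pl_less_Suc[OF a] in blast)

text \<open>Every ladder is the image of the naturals under the automorphism \<open>pl a\<close>, so
  facts about the naturals transfer to all ladders by conjugation.\<close>

definition ladder :: "(nat \<Rightarrow> rat) \<Rightarrow> bool" where
  "ladder a \<longleftrightarrow> strict_mono a \<and> (\<forall>y. \<exists>n. y < a n)"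

lemma ladderI:
  assumes "\<And>n. a n < a (Suc n)" "\<And>n. of_nat n \<le> a n + c"
  shows "ladder a"
proof -
  have "\<exists>n. y < a n" for y
  proof -
    obtain n where "y + c < of_nat n" using reals_Archimedean2 by blast
    then have "y < a n" using assms(2)[of n] by simp
    then show ?thesis ..
  qed
  then show ?thesis using assms(1) by (auto simp: ladder_def strict_mono_Suc_iff)
qed

lemma pl_auts:
  assumes "ladder a"
  shows "pl a \<in> order_auts"
proof (rule order_autsI)
  show "surj (pl a)" using assms range_pl[of a] by (simp add: ladder_def)
  show "pl a x < pl a y" if "x < y" for x y using assms that pl_less by (simp add: ladder_def)
qed

lemma small_index_conj_rst:
  assumes "u \<in> order_auts" "rst S \<subseteq> {f. u \<circ> f \<circ> finv u \<in> H}" "\<And>y. y \<in> T \<Longrightarrow> finv u y \<in> S"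
  shows "rst T \<subseteq> H"
proof
  fix f assume "f \<in> rst T"
  then have "finv u \<circ> f \<circ> finv (finv u) \<in> rst S" by (rule rst_conj) (use assms in auto)
  then have "finv u \<circ> f \<circ> u \<in> {f. u \<circ> f \<circ> finv u \<in> H}" using assms by auto
  then show "f \<in> H" using small_index_conjD[OF assms(1)] by blast
qed

text \<open>In every unit interval the first third is stretched over two thirds and the rest is
  compressed into the last third, so the middle third is moved off itself, as
  \<open>rst_commutator\<close> demands.\<close>

definition squeeze :: "rat \<Rightarrow> rat" where
  "squeeze x = of_int \<lfloor>x\<rfloor> + (if frac x < 1/3 then 2 * frac x else (frac x + 1) / 2)"

lemma floor_squeeze [simp]: "\<lfloor>squeeze x\<rfloor> = \<lfloor>x\<rfloor>"
  using frac_ge_0[of x] frac_lt_1[of x] by (intro floor_unique) (auto simp: squeeze_def)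

lemma frac_squeeze: "frac (squeeze x) = (if frac x < 1/3 then 2 * frac x else (frac x + 1) / 2)"
  unfolding frac_def[of "squeeze x"] floor_squeeze by (simp add: squeeze_def)

lemma rat_eqI_floor_frac: "\<lfloor>x\<rfloor> = \<lfloor>y\<rfloor> \<Longrightarrow> frac x = frac y \<Longrightarrow> x = (y::rat)"
  by (simp add: frac_def)

lemma squeeze_auts: "squeeze \<in> order_auts"
proof (rule order_autsI)
  show "surj squeeze"
  proof (rule surjI)
    fix x :: rat
    \<comment> \<open>The two linear pieces inverted; the breakpoint is now at 2/3.\<close>
    define y where "y = of_int \<lfloor>x\<rfloor> + (if frac x < 2/3 then frac x / 2 else 2 * frac x - 1)"
    have f: "\<lfloor>y\<rfloor> = \<lfloor>x\<rfloor>"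
      using frac_ge_0[of x] frac_lt_1[of x] by (intro floor_unique) (auto simp: y_def)
    have fr: "frac y = (if frac x < 2/3 then frac x / 2 else 2 * frac x - 1)"
      unfolding frac_def[of y] f unfolding y_def by simp
    have "squeeze y = x"
    proof (rule rat_eqI_floor_frac)
      show "\<lfloor>squeeze y\<rfloor> = \<lfloor>x\<rfloor>" unfolding floor_squeeze by (rule f)
      show "frac (squeeze y) = frac x"
        unfolding frac_squeeze fr by (cases "frac x < 2/3") auto
    qed
    then show "squeeze (of_int \<lfloor>x\<rfloor> + (if frac x < 2/3 then frac x / 2 else 2 * frac x - 1)) = x"
      unfolding y_def .
  qed
next
  fix x y :: rat assume xy: "x < y"
  show "squeeze x < squeeze y"
  proof (cases "\<lfloor>x\<rfloor> = \<lfloor>y\<rfloor>")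
    case True
    then have "frac x < frac y" using xy unfolding frac_def by simp
    then show ?thesis unfolding squeeze_def True by auto
  next
    case False
    then have "\<lfloor>squeeze x\<rfloor> < \<lfloor>squeeze y\<rfloor>" using floor_mono[of x y] xy by simp
    then show ?thesis using floor_mono[of "squeeze y" "squeeze x"] by (meson not_le)
  qed
qed

lemma floor_less_cases: "\<lfloor>x\<rfloor> \<noteq> \<lfloor>y\<rfloor> \<Longrightarrow> x < y \<longleftrightarrow> \<lfloor>x\<rfloor> < \<lfloor>y::rat\<rfloor>"
  using floor_mono[of x y] floor_mono[of y x] by linarith

text \<open>The even unit intervals are sorted into infinitely many unbounded families, and for one
  of them \<open>H\<close> contains all commutators. By the infinite-product trick these include
  \<open>rst\<close> of the middle thirds. Parity is recorded so that the odd unit intervals are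
  known to lie in the gaps.\<close>

lemma small_index_ladder:
  assumes H: "small_index H"
  obtains a where "ladder a" "\<And>l x. a (2 * l) \<le> x \<Longrightarrow> x < a (2 * l + 1) \<Longrightarrow> even \<lfloor>x\<rfloor>"
    "rst (\<Union>l. {a (2 * l)..<a (2 * l + 1)}) \<subseteq> H"
proof -
  define S where "S n = {x :: rat. 0 \<le> x \<and> even \<lfloor>x\<rfloor> \<and> fst (prod_decode (nat \<lfloor>x\<rfloor> div 2)) = n}" for n
  have "disjoint_family S" by (auto simp: S_def disjoint_family_on_def)
  then obtain n where
    n: "\<And>u v. u \<in> rst (S n) \<Longrightarrow> v \<in> rst (S n) \<Longrightarrow> u \<circ> v \<circ> finv u \<circ> finv v \<in> H"
    by (rule small_index_commutators[OF H]) (rule that)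
  define t where "t = (\<lambda>x. if x \<in> S n then squeeze x else x)"
  have pos: "0 \<le> squeeze x \<longleftrightarrow> 0 \<le> x" for x using floor_squeeze[of x] by (metis zero_le_floor)
  have sq: "squeeze x \<in> S n \<longleftrightarrow> x \<in> S n" for x by (simp add: S_def pos)
  have t: "t \<in> rst (S n)" unfolding t_def
  proof (rule restrict_rst[OF squeeze_auts sq])
    fix x y assume xy: "x \<in> S n" "y \<notin> S n"
    show "squeeze x < y \<longleftrightarrow> x < y"
    proof (cases "\<lfloor>x\<rfloor> = \<lfloor>y\<rfloor>")
      case True
      then have "0 \<le> x \<longleftrightarrow> 0 \<le> y" by (metis zero_le_floor)
      then show ?thesis using xy True by (simp add: S_def)
    next
      case False
      then show ?thesis by (simp add: floor_less_cases)
    qed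
  qed
  \<comment> \<open>\<open>Y\<close> collects the middle thirds; \<open>Z\<close> adds the last
    thirds as room into which \<open>t\<close> pushes them.\<close>
  define Y where "Y = {x \<in> S n. 1/3 \<le> frac x \<and> frac x < 2/3}"
  define Z where "Z = {x \<in> S n. 1/3 \<le> frac x}"
  have tZ: "t x \<in> Z - Y" if "x \<in> Z" for x
    using that sq by (auto simp: Z_def Y_def t_def frac_squeeze)
  have YH: "rst Y \<subseteq> H"
  proof
    fix g assume "g \<in> rst Y"
    then obtain h where "h \<in> rst (S n)" "g = h \<circ> t \<circ> finv h \<circ> finv t"
      using rst_commutator[OF t _ _ tZ, of g] by (auto simp: Y_def Z_def)
    then show "g \<in> H" using n t by blast
  qed
  \<comment> \<open>Even entries are the left ends of the middle thirds, odd entries the right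
    ends.\<close>
  define a where "a j = of_nat (2 * prod_encode (n, j div 2)) + (if even j then 1/3 else 2/3 :: rat)" for j
  have enc: "prod_encode (n, l) < prod_encode (n, Suc l)" "l \<le> prod_encode (n, l)" for l
    by (simp add: prod_encode_def) (rule le_prod_encode_2)
  have al: "\<lfloor>x\<rfloor> = int (2 * prod_encode (n, l)) \<and> 1/3 \<le> frac x \<and> frac x < 2/3"
    if "a (2 * l) \<le> x" "x < a (2 * l + 1)" for l x
  proof -
    have f: "\<lfloor>x\<rfloor> = int (2 * prod_encode (n, l))"
      using that by (intro floor_unique) (auto simp: a_def)
    have "frac x = x - of_nat (2 * prod_encode (n, l))" by (simp add: frac_def f)
    then show ?thesis using f that by (auto simp: a_def)
  qed
  show thesis
  proof
    show "ladder a"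
    proof (rule ladderI[of _ 1])
      fix j
      show "a j < a (Suc j)"
      proof (cases "even j")
        case True
        then show ?thesis by (simp add: a_def)
      next
        case False
        then have e: "Suc j div 2 = Suc (j div 2)" by presburger
        have "(of_nat (2 * prod_encode (n, j div 2)) :: rat) + 1 \<le>
            of_nat (2 * prod_encode (n, Suc (j div 2)))"
          using enc(1)[of "j div 2"] by (simp flip: of_nat_Suc of_nat_add add: algebra_simps)
        then show ?thesis using False e by (simp add: a_def)
      qed
      have "j \<le> 2 * prod_encode (n, j div 2) + 1" using enc(2)[of "j div 2"] by linarith
      then have "of_nat j \<le> (of_nat (2 * prod_encode (n, j div 2) + 1) :: rat)"
        by (simp only: of_nat_le_iff)
      then show "of_nat j \<le> a j + 1" by (simp add: a_def)
    qed
    show "even \<lfloor>x\<rfloor>" if "a (2 * l) \<le> x" "x < a (2 * l + 1)" for l x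
      using al[OF that] by simp
    have "(\<Union>l. {a (2 * l)..<a (2 * l + 1)}) \<subseteq> Y"
    proof clarify
      fix x l assume x: "x \<in> {a (2 * l)..<a (2 * l + 1)}"
      then have f: "\<lfloor>x\<rfloor> = int (2 * prod_encode (n, l))" "1/3 \<le> frac x" "frac x < 2/3"
        using al[of l x] by auto
      moreover have "0 \<le> x" using f(1) by (metis of_nat_0_le_iff zero_le_floor)
      ultimately show "x \<in> Y" by (simp add: Y_def S_def nat_mult_distrib)
    qed
    then show "rst (\<Union>l. {a (2 * l)..<a (2 * l + 1)}) \<subseteq> H" using rst_mono YH by blast
  qed
qed

section \<open>Subgroups of countable index near infinity\<close>

lemma small_index_conj_mem:
  assumes "small_index H" "h \<in> H" "f \<in> order_auts" "h \<circ> f \<circ> finv h \<in> H"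
  shows "f \<in> H"
proof -
  have h: "h \<in> order_auts" using assms small_indexD(1) by blast
  have "finv h \<circ> (h \<circ> f \<circ> finv h) \<circ> h \<in> H" 
    by (intro small_indexD(2,3)[OF assms(1)] assms)
  moreover have "finv h \<circ> (h \<circ> f \<circ> finv h) \<circ> h = f" using h by (simp add: fun_eq_iff)
  ultimately show ?thesis by simp
qed

text \<open>Coding the whole segment below \<open>i\<close> instead of one bit makes two distinct
  sets differ at all large \<open>i\<close>.\<close>

definition initial_code :: "nat set \<Rightarrow> nat \<Rightarrow> nat" where
  "initial_code t i = set_encode (t \<inter> {..<i})"

lemma initial_code_neq:
  assumes "d < i" "d \<in> s \<longleftrightarrow> d \<notin> t"
  shows "initial_code s i \<noteq> initial_code t i"
proof
  assume "initial_code s i = initial_code t i"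
  then have "s \<inter> {..<i} = t \<inter> {..<i}" by (simp add: initial_code_def set_encode_eq)
  then show False using assms by blast
qed

text \<open>The intervals \<open>[k/(k+1), (k+1)/(k+2))\<close> are pairwise disjoint, so the piecewise linear maps
  \<open>g t\<close> below, which shrink every odd block \<open>[2i+1, 2i+2)\<close> to a translate of the interval with
  index \<open>initial_code t i\<close>, move the odd blocks eventually off each other.\<close>

lemma small_index_odd_of_even:
  assumes H: "small_index H" and even: "rst {x :: rat. 0 \<le> x \<and> even \<lfloor>x\<rfloor>} \<subseteq> H"
  obtains n :: nat where "rst {x. of_nat n \<le> x \<and> odd \<lfloor>x\<rfloor>} \<subseteq> H"
proof -
  define q where "q k = (of_nat k / of_nat (Suc k) :: rat)" for k
  have q0: "0 \<le> q k" "q k < 1" for k by (simp_all add: q_def)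
  have qS: "q k < q (Suc k)" for k by (simp add: q_def divide_simps) (simp add: algebra_simps)
  have q_mono: "q k \<le> q l" if "k \<le> l" for k l
    using lift_Suc_mono_le[of q k l] qS that by (simp add: less_imp_le)
  \<comment> \<open>After the start at 0 come the two ends of each shrunken odd block, so
    \<open>pl\<close> stretches the even blocks over the remaining gaps.\<close>
  define b where "b t j = (if j = 0 then 0 else if odd j then of_nat j + q (initial_code t (j div 2))
    else of_nat (j - 1) + q (Suc (initial_code t (j div 2 - 1))))" for t j
  define g where "g t = pl (b t)" for t
  have b_odd: "b t (2 * i + 1) = of_nat (2 * i + 1) + q (initial_code t i)"
    "b t (2 * i + 2) = of_nat (2 * i + 1) + q (Suc (initial_code t i))" for t i
    by (simp_all add: b_def)
  have lad: "ladder (b t)" for t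
  proof (rule ladderI[of _ 1])
    fix j :: nat
    have "j = 0 \<or> (\<exists>i. j = 2 * i + 1) \<or> (\<exists>i. j = 2 * i + 2)" by presburger
    then consider "j = 0" | i where "j = 2 * i + 1" | i where "j = 2 * i + 2" by blast
    then show "b t j < b t (Suc j)"
    proof cases
      case 1
      then show ?thesis using b_odd(1)[of t 0] q0(1)[of "initial_code t 0"] by (simp add: b_def)
    next
      case 2
      then show ?thesis using b_odd[of t i] qS[of "initial_code t i"] by simp
    next
      case 3
      then show ?thesis
        using b_odd(2)[of t i] b_odd(1)[of t "Suc i"] q0(2)[of "Suc (initial_code t i)"]
          q0(1)[of "initial_code t (Suc i)"] by simp
    qed
    show "of_nat j \<le> b t j + 1"
      using q0(1)[of "initial_code t (j div 2)"] q0(1)[of "Suc (initial_code t (j div 2 - 1))"]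
      by (cases j) (auto simp: b_def)
  qed
  have ga: "g t \<in> order_auts" for t unfolding g_def by (rule pl_auts[OF lad])
  have g_nat: "g t (of_nat j) = b t j" for t j by (simp add: g_def)
  have g_nonneg: "0 \<le> g t x \<longleftrightarrow> 0 \<le> x" for t x
    using aut_le_iff[OF ga, of t 0 x] g_nat[of t 0] by (simp add: b_def)
  have g_odd: "\<exists>i. \<lfloor>x\<rfloor> = 2 * int i + 1 \<and> \<lfloor>g t x\<rfloor> = 2 * int i + 1 \<and>
      q (initial_code t i) \<le> frac (g t x) \<and> frac (g t x) < q (Suc (initial_code t i))"
    if x: "0 \<le> x" "odd \<lfloor>x\<rfloor>" for x t
  proof -
    have "0 \<le> \<lfloor>x\<rfloor>" using x(1) by simp
    then have "\<lfloor>x\<rfloor> = 2 * int (nat (\<lfloor>x\<rfloor> div 2)) + 1"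
      using odd_two_times_div_two_succ[OF x(2)] by (simp add: pos_imp_zdiv_nonneg_iff)
    then obtain i where i: "\<lfloor>x\<rfloor> = 2 * int i + 1" by blast
    have "of_nat (2 * i + 1) \<le> x" "x < of_nat (2 * i + 2)" using i by linarith+
    then have "g t (of_nat (2 * i + 1)) \<le> g t x" "g t x < g t (of_nat (2 * i + 2))"
      using ga by simp_all
    then have *: "of_nat (2 * i + 1) + q (initial_code t i) \<le> g t x"
      "g t x < of_nat (2 * i + 1) + q (Suc (initial_code t i))"
      unfolding g_nat b_odd by simp_all
    then have "\<lfloor>g t x\<rfloor> = int (2 * i + 1)"
      using q0(1)[of "initial_code t i"] q0(2)[of "Suc (initial_code t i)"] by (intro floor_unique) auto
    moreover from this have "frac (g t x) = g t x - of_nat (2 * i + 1)" by (simp add: frac_def)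
    ultimately show ?thesis using * i by auto
  qed
  obtain s t where "s \<noteq> t" and h: "finv (g s) \<circ> g t \<in> H"
    using small_index_pigeonhole[OF H uncountable_nat_sets, of g] ga by metis
  obtain d where d: "d \<in> s \<longleftrightarrow> d \<notin> t" using \<open>s \<noteq> t\<close> by blast
  let ?h = "finv (g s) \<circ> g t"
  \<comment> \<open>Such an \<open>x\<close> lies in a block \<open>2 * i + 1\<close> with
    \<open>d < i\<close>. If \<open>?h x\<close> were in an odd block as well, \<open>g t x\<close>
    would lie in the target intervals of two different codes.\<close>
  have h_even: "0 \<le> ?h x \<and> even \<lfloor>?h x\<rfloor>" if x: "of_nat (2 * d + 2) \<le> x" "odd \<lfloor>x\<rfloor>" for x
  proof -
    define z where "z = ?h x"
    have gz: "g s z = g t x" using ga by (simp add: z_def)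
    have x0: "0 \<le> x" using x(1) by (rule order_trans[rotated]) simp
    have z0: "0 \<le> z" using g_nonneg[of t x] g_nonneg[of s z] x0 gz by simp
    have "even \<lfloor>z\<rfloor>"
    proof (rule ccontr)
      assume "odd \<lfloor>z\<rfloor>"
      from g_odd[OF z0 this, of s] obtain j where j: "\<lfloor>g t x\<rfloor> = 2 * int j + 1"
        "q (initial_code s j) \<le> frac (g t x)" "frac (g t x) < q (Suc (initial_code s j))"
        unfolding gz by blast
      from g_odd[OF x0 x(2), of t] obtain i where
        i: "\<lfloor>x\<rfloor> = 2 * int i + 1" "\<lfloor>g t x\<rfloor> = 2 * int i + 1"
        "q (initial_code t i) \<le> frac (g t x)" "frac (g t x) < q (Suc (initial_code t i))"
        by blast
      have ji: "j = i" using i(2) j(1) by simp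
      have "d < i" using i(1) x(1) by linarith
      then have "initial_code s i \<noteq> initial_code t i" using initial_code_neq d by blast
      then consider "Suc (initial_code s i) \<le> initial_code t i" | "Suc (initial_code t i) \<le> initial_code s i"
        by linarith
      then show False
      proof cases
        case 1
        then show False using q_mono[OF 1] i(3) j(3) ji by simp
      next
        case 2
        then show False using q_mono[OF 2] i(4) j(2) ji by simp
      qed
    qed
    then show ?thesis using z0 by (simp add: z_def)
  qed
  have "rst {x. of_nat (2 * d + 2) \<le> x \<and> odd \<lfloor>x\<rfloor>} \<subseteq> H"
  proof
    fix f :: "rat \<Rightarrow> rat" assume f: "f \<in> rst {x. of_nat (2 * d + 2) \<le> x \<and> odd \<lfloor>x\<rfloor>}"
    have "?h \<circ> f \<circ> finv ?h \<in> rst {x :: rat. 0 \<le> x \<and> even \<lfloor>x\<rfloor>}"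
      using h_even small_indexD(1)[OF H h] by (intro rst_conj[OF f]) auto
    then have "?h \<circ> f \<circ> finv ?h \<in> H" using even by blast
    then show "f \<in> H" by (rule small_index_conj_mem[OF H h rstD(1)[OF f]])
  qed
  then show thesis by (rule that)
qed

text \<open>In the coordinate \<open>pl a\<close> the ladder intervals become the even unit
  intervals, and \<open>small_index_odd_of_even\<close> applies. Back in the original coordinate,
  points with odd floor avoid the ladder intervals and so come from odd blocks.\<close>

lemma small_index_odd:
  assumes H: "small_index H"
  obtains n :: nat where "rst {x :: rat. of_nat n \<le> x \<and> odd \<lfloor>x\<rfloor>} \<subseteq> H"
proof -
  obtain a where a: "ladder a"
    and ev: "\<And>l x. a (2 * l) \<le> x \<Longrightarrow> x < a (2 * l + 1) \<Longrightarrow> even \<lfloor>x\<rfloor>"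
    and aH: "rst (\<Union>l. {a (2 * l)..<a (2 * l + 1)}) \<subseteq> H"
    by (rule small_index_ladder[OF H]) (rule that)
  let ?u = "pl a"
  let ?H = "{f. ?u \<circ> f \<circ> finv ?u \<in> H}"
  have u: "?u \<in> order_auts" by (rule pl_auts[OF a])
  have H': "small_index ?H" by (rule small_index_conj_aut[OF H u])
  have block: "a (2 * l) \<le> ?u x \<and> ?u x < a (2 * l + 1)" if "\<lfloor>x\<rfloor> = 2 * int l" for x l
  proof -
    have "of_nat (2 * l) \<le> x" "x < of_nat (2 * l + 1)" using that by linarith+
    then have "?u (of_nat (2 * l)) \<le> ?u x" "?u x < ?u (of_nat (2 * l + 1))" using u by simp_all
    then show ?thesis unfolding pl_of_nat by simp
  qed
  have ex: "\<exists>l. \<lfloor>x\<rfloor> = 2 * int l" if "0 \<le> x" "even \<lfloor>x\<rfloor>" for x :: rat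
    using that by (intro exI[of _ "nat (\<lfloor>x\<rfloor> div 2)"]) auto
  have "rst {x :: rat. 0 \<le> x \<and> even \<lfloor>x\<rfloor>} \<subseteq> ?H"
  proof
    fix f :: "rat \<Rightarrow> rat" assume f: "f \<in> rst {x. 0 \<le> x \<and> even \<lfloor>x\<rfloor>}"
    have "?u \<circ> f \<circ> finv ?u \<in> rst (\<Union>l. {a (2 * l)..<a (2 * l + 1)})"
      using block ex by (intro rst_conj[OF f u]) fastforce
    then show "f \<in> ?H" using aH by blast
  qed
  then obtain n where n: "rst {x :: rat. of_nat n \<le> x \<and> odd \<lfloor>x\<rfloor>} \<subseteq> ?H"
    by (rule small_index_odd_of_even[OF H']) (rule that)
  obtain N :: nat where N: "a n \<le> of_nat N"
    using reals_Archimedean2[of "a n"] less_imp_le by blast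
  have "rst {x. of_nat N \<le> x \<and> odd \<lfloor>x\<rfloor>} \<subseteq> H"
  proof (rule small_index_conj_rst[OF u n])
    fix y :: rat assume y: "y \<in> {x. of_nat N \<le> x \<and> odd \<lfloor>x\<rfloor>}"
    define x where "x = finv ?u y"
    have ux: "?u x = y" using u by (simp add: x_def)
    have "?u (of_nat n) \<le> ?u x" unfolding ux pl_of_nat using y N by auto
    then have nx: "of_nat n \<le> x" by (simp only: aut_le_iff[OF u])
    moreover have "odd \<lfloor>x\<rfloor>"
    proof
      assume "even \<lfloor>x\<rfloor>"
      moreover have "0 \<le> x" using nx by (rule order_trans[rotated]) simp
      ultimately obtain l where "\<lfloor>x\<rfloor> = 2 * int l" using ex by blast
      then have "even \<lfloor>y\<rfloor>" using block[of x l] ev[of l y] ux by simp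
      then show False using y by simp
    qed
    ultimately show "finv ?u y \<in> {x. of_nat n \<le> x \<and> odd \<lfloor>x\<rfloor>}" by (simp add: x_def)
  qed
  then show thesis by (rule that)
qed

text \<open>Conjugation by a shift by 1 exchanges the parities.\<close>

lemma small_index_even:
  assumes H: "small_index H"
  obtains n :: nat where "rst {x :: rat. of_nat n \<le> x \<and> even \<lfloor>x\<rfloor>} \<subseteq> H"
proof -
  let ?u = "\<lambda>x :: rat. x + 1"
  have u: "?u \<in> order_auts"
    by (rule order_autsI[OF surjI[of _ "\<lambda>x. x - 1"]]) auto
  have uinv: "finv ?u y = y - 1" for y using aut_inv_left[OF u, of "y - 1"] by simp
  obtain n :: nat
    where n: "rst {x. of_nat n \<le> x \<and> odd \<lfloor>x\<rfloor>} \<subseteq> {f. ?u \<circ> f \<circ> finv ?u \<in> H}"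
    by (rule small_index_odd[OF small_index_conj_aut[OF H u]]) (rule that)
  have "rst {x. of_nat (Suc n) \<le> x \<and> even \<lfloor>x\<rfloor>} \<subseteq> H"
    by (rule small_index_conj_rst[OF u n]) (simp add: uinv)
  then show thesis by (rule that)
qed

text \<open>An automorphism fixing the naturals from \<open>n\<close> on preserves each unit
  interval there, so it is the product of its parts on the odd and the even intervals.\<close>

lemma small_index_nats:
  assumes H: "small_index H"
  shows "\<exists>n :: nat. \<forall>f :: rat \<Rightarrow> rat. f \<in> order_auts \<and>
    (\<forall>i\<ge>n. f (of_nat i) = of_nat i) \<and> (\<forall>x < of_nat n. f x = x) \<longrightarrow> f \<in> H"
proof -
  obtain n1 :: nat where n1: "rst {x :: rat. of_nat n1 \<le> x \<and> odd \<lfloor>x\<rfloor>} \<subseteq> H"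
    by (rule small_index_odd[OF H]) (rule that)
  obtain n2 :: nat where n2: "rst {x :: rat. of_nat n2 \<le> x \<and> even \<lfloor>x\<rfloor>} \<subseteq> H"
    by (rule small_index_even[OF H]) (rule that)
  define n where "n = max n1 n2"
  show ?thesis
  proof (intro exI[of _ n] allI impI)
    fix f :: "rat \<Rightarrow> rat"
    assume "f \<in> order_auts \<and> (\<forall>i\<ge>n. f (of_nat i) = of_nat i) \<and> (\<forall>x < of_nat n. f x = x)"
    then have f: "f \<in> order_auts" and fi: "\<And>i. n \<le> i \<Longrightarrow> f (of_nat i) = of_nat i"
      and fx: "\<And>x. x < of_nat n \<Longrightarrow> f x = x"
      by auto
    have ge: "of_nat n \<le> f x \<longleftrightarrow> of_nat n \<le> x" for x
      using aut_le_iff[OF f, of "of_nat n" x] fi[of n] by simp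
    have fl: "\<lfloor>f x\<rfloor> = \<lfloor>x\<rfloor>" if "of_nat n \<le> x" for x
    proof -
      define i where "i = nat \<lfloor>x\<rfloor>"
      have x0: "0 \<le> x" using that by (rule order_trans[rotated]) simp
      then have i: "of_nat i \<le> x" "x < of_nat (Suc i)" unfolding i_def by linarith+
      have "n \<le> i" unfolding i_def using that by (simp add: le_nat_iff le_floor_iff)
      then have "of_nat i \<le> f x" "f x < of_nat (Suc i)"
        using i fi[of i] fi[of "Suc i"] aut_le_iff[OF f, of "of_nat i" x]
          aut_less_iff[OF f, of x "of_nat (Suc i)"] by simp_all
      then have "\<lfloor>f x\<rfloor> = int i" by linarith
      then show ?thesis using x0 by (simp add: i_def)
    qed
    have r: "(\<lambda>x. if x \<in> {x. of_nat n \<le> x \<and> P \<lfloor>x\<rfloor>} then f x else x) \<in>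
        rst {x. of_nat n \<le> x \<and> P \<lfloor>x\<rfloor>}" for P
    proof (rule restrict_rst[OF f])
      show "f x \<in> {x. of_nat n \<le> x \<and> P \<lfloor>x\<rfloor>} \<longleftrightarrow> x \<in> {x. of_nat n \<le> x \<and> P \<lfloor>x\<rfloor>}" for x
        using ge fl by auto
      fix x y :: rat
      assume x: "x \<in> {x. of_nat n \<le> x \<and> P \<lfloor>x\<rfloor>}" and y: "y \<notin> {x. of_nat n \<le> x \<and> P \<lfloor>x\<rfloor>}"
      show "f x < y \<longleftrightarrow> x < y"
      proof (cases "of_nat n \<le> y")
        case True
        then have "\<lfloor>x\<rfloor> \<noteq> \<lfloor>y\<rfloor>" using x y by auto
        moreover have "\<lfloor>f x\<rfloor> = \<lfloor>x\<rfloor>" using x fl by simp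
        ultimately show ?thesis using floor_less_cases[of x y] floor_less_cases[of "f x" y] by simp
      next
        case False
        then show ?thesis using x ge[of x] by auto
      qed
    qed
    define g where "g P = (\<lambda>x. if x \<in> {x. of_nat n \<le> x \<and> P \<lfloor>x\<rfloor>} then f x else x)"
      for P :: "int \<Rightarrow> bool"
    have "{x :: rat. of_nat n \<le> x \<and> odd \<lfloor>x\<rfloor>} \<subseteq> {x. of_nat n1 \<le> x \<and> odd \<lfloor>x\<rfloor>}"
      "{x :: rat. of_nat n \<le> x \<and> even \<lfloor>x\<rfloor>} \<subseteq> {x. of_nat n2 \<le> x \<and> even \<lfloor>x\<rfloor>}"
      by (auto simp: n_def of_nat_max)
    note sub = this
    have gr: "g P \<in> rst {x. of_nat n \<le> x \<and> P \<lfloor>x\<rfloor>}" for P unfolding g_def by (rule r)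
    have "g odd \<in> H" by (rule subsetD[OF n1 subsetD[OF rst_mono[OF sub(1)] gr]])
    moreover have "g even \<in> H" by (rule subsetD[OF n2 subsetD[OF rst_mono[OF sub(2)] gr]])
    ultimately have "g odd \<circ> g even \<in> H" by (rule small_indexD(2)[OF H])
    moreover have "f x = (g odd \<circ> g even) x" for x
    proof (cases "of_nat n \<le> x")
      case True
      then show ?thesis using fl[OF True] ge[of x] by (cases "even \<lfloor>x\<rfloor>") (simp_all add: g_def)
    next
      case False
      then show ?thesis using fx[of x] by (simp add: g_def)
    qed
    then have "f = g odd \<circ> g even" by (rule ext)
    ultimately show "f \<in> H" by simp
  qed
qed

lemma small_index_fix_ladder:
  assumes H: "small_index H" and a: "ladder a"
  shows "\<exists>n. \<forall>f. f \<in> order_auts \<and>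
    (\<forall>i\<ge>n. f (a i) = a i) \<and> (\<forall>x<a n. f x = x) \<longrightarrow> f \<in> H"
proof -
  let ?u = "pl a"
  have u: "?u \<in> order_auts" by (rule pl_auts[OF a])
  have uinv: "finv ?u (a i) = of_nat i" for i using u by (simp add: aut_inv_eq_iff)
  obtain n where n: "\<And>f. f \<in> order_auts \<Longrightarrow> (\<And>i. n \<le> i \<Longrightarrow> f (of_nat i) = of_nat i) \<Longrightarrow>
      (\<And>x. x < of_nat n \<Longrightarrow> f x = x) \<Longrightarrow> f \<in> {f. ?u \<circ> f \<circ> finv ?u \<in> H}"
    using small_index_nats[OF small_index_conj_aut[OF H u]] by blast
  show ?thesis
  proof (intro exI[of _ n] allI impI)
    fix f assume "f \<in> order_auts \<and> (\<forall>i\<ge>n. f (a i) = a i) \<and> (\<forall>x<a n. f x = x)"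
    then have f: "f \<in> order_auts" and fa: "\<And>i. n \<le> i \<Longrightarrow> f (a i) = a i"
      and fx: "\<And>x. x < a n \<Longrightarrow> f x = x"
      by auto
    have "finv ?u \<circ> f \<circ> ?u \<in> {f. ?u \<circ> f \<circ> finv ?u \<in> H}"
    proof (rule n)
      fix x :: rat assume "x < of_nat n"
      then have "?u x < a n" using aut_less_iff[OF u, of x "of_nat n"] by simp
      then show "(finv ?u \<circ> f \<circ> ?u) x = x" using u fx by simp
    qed (use u f fa uinv in auto)
    then show "f \<in> H" by (rule small_index_conjD[OF u])
  qed
qed

text \<open>Otherwise every \<open>c\<close> has a bad bound \<open>\<beta> c\<close>, and some
  ladder leaps over these bounds at each step. Far enough out, elements supported between a rung and
  its bad bound fix the ladder and lie in \<open>H\<close> after all.\<close>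

lemma small_index_bounded:
  assumes H: "small_index H"
  obtains c :: rat where "\<And>b. rst {c<..<b} \<subseteq> H"
proof (rule ccontr)
  assume "\<not> thesis"
  then have "\<forall>c. \<exists>b. \<not> rst {c<..<b} \<subseteq> H" using that by metis
  then obtain \<beta> where \<beta>: "\<And>c. \<not> rst {c<..<\<beta> c} \<subseteq> H" by metis
  define a where "a = rec_nat (0::rat) (\<lambda>_ x. max (\<beta> x) (x + 1))"
  have aS: "a 0 = 0" "a (Suc n) = max (\<beta> (a n)) (a n + 1)" for n by (simp_all add: a_def)
  have "ladder a"
  proof (rule ladderI[of _ 0])
    show "a n < a (Suc n)" for n by (simp add: aS less_max_iff_disj)
    show "of_nat n \<le> a n + 0" for n by (induction n) (auto simp: aS max_def)
  qed
  then have mono: "strict_mono a" by (simp add: ladder_def)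
  obtain n where n: "\<And>f. f \<in> order_auts \<Longrightarrow>
      (\<And>i. n \<le> i \<Longrightarrow> f (a i) = a i) \<Longrightarrow> (\<And>x. x < a n \<Longrightarrow> f x = x) \<Longrightarrow> f \<in> H"
    using small_index_fix_ladder[OF H \<open>ladder a\<close>] by blast
  have "rst {a n<..<\<beta> (a n)} \<subseteq> H"
  proof
    fix f assume f: "f \<in> rst {a n<..<\<beta> (a n)}"
    show "f \<in> H"
    proof (rule n)
      fix i assume "n \<le> i"
      then consider "i = n" | "Suc n \<le> i" by linarith
      then have "a i \<notin> {a n<..<\<beta> (a n)}"
      proof cases
        case 2
        then have "a (Suc n) \<le> a i" using mono by (simp add: strict_mono_less_eq)
        then show ?thesis by (simp add: aS)
      qed simp
      then show "f (a i) = a i" using rstD(2)[OF f] by blast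
    qed (use rstD[OF f] in auto)
  qed
  then show False using \<beta> by blast
qed

text \<open>With equal initial entries both interpolations are the same translation on the negative
  rationals, so their quotient is the identity up to \<open>a 0\<close>.\<close>

lemma ladder_transport:
  assumes a: "ladder a" and b: "ladder b" and "a 0 = b 0"
  obtains h where "h \<in> rst {a 0<..}" "\<And>j. h (a j) = b j"
proof
  have ao: "pl a \<in> order_auts" and bo: "pl b \<in> order_auts" using pl_auts a b by blast+
  let ?h = "pl b \<circ> finv (pl a)"
  show ab: "?h (a j) = b j" for j
  proof -
    have "finv (pl a) (a j) = of_nat j" using ao by (simp add: aut_inv_eq_iff)
    then show ?thesis by simp
  qed
  show "?h \<in> rst {a 0<..}"
  proof (rule rstI)
    fix x assume "x \<notin> {a 0<..}"
    then consider "x = a 0" | "x < a 0" by force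
    then show "?h x = x"
    proof cases
      case 1
      then show ?thesis using ab[of 0] assms(3) by simp
    next
      case 2
      then have "pl a (x - a 0) = x" "pl b (x - a 0) = x" using assms(3) by (simp_all add: pl_neg)
      moreover from this have "finv (pl a) x = x - a 0" using ao by (simp add: aut_inv_eq_iff)
      ultimately show ?thesis by simp
    qed
  qed (use ao bo in blast)
qed

lemma restrict_atLeast:
  fixes f :: "'a::linorder \<Rightarrow> 'a"
  assumes f: "f \<in> order_auts" and p: "f p = p"
  shows "(\<lambda>x. if x \<in> {p..} then f x else x) \<in> rst {p..}"
proof (rule restrict_rst[OF f])
  have ge: "p \<le> f x \<longleftrightarrow> p \<le> x" for x using aut_le_iff[OF f, of p x] p by simp
  show "f x \<in> {p..} \<longleftrightarrow> x \<in> {p..}" for x using ge by simp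
  show "f x < y \<longleftrightarrow> x < y" if "x \<in> {p..}" "y \<notin> {p..}" for x y
    using that ge[of x] by auto
qed

lemma small_index_above:
  assumes H: "small_index H"
  obtains c :: rat where "rst {c<..} \<subseteq> H"
proof -
  obtain c where c: "\<And>b. rst {c<..<b} \<subseteq> H" by (rule small_index_bounded[OF H]) (rule that)
  \<comment> \<open>An element fixing a ladder is a tail beyond some rung, which lies in
    \<open>H\<close> by \<open>small_index_fix_ladder\<close>, times a part with bounded support,
    which lies in \<open>H\<close> by the choice of \<open>c\<close>.\<close>
  have step: "f \<in> H" if f: "f \<in> rst {c<..}" and a: "ladder a" and fa: "\<And>i. f (a i) = a i" for f a
  proof -
    have fo: "f \<in> order_auts" using rstD(1)[OF f] .
    obtain n where n: "\<And>f. f \<in> order_auts \<Longrightarrow>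
        (\<And>i. n \<le> i \<Longrightarrow> f (a i) = a i) \<Longrightarrow> (\<And>x. x < a n \<Longrightarrow> f x = x) \<Longrightarrow> f \<in> H"
      using small_index_fix_ladder[OF H a] by blast
    define k where "k = (\<lambda>x. if x \<in> {a n..} then f x else x)"
    have k: "k \<in> rst {a n..}" unfolding k_def by (rule restrict_atLeast[OF fo fa])
    have ko: "k \<in> order_auts" using rstD(1)[OF k] .
    have kH: "k \<in> H"
      by (rule n[OF ko]) (auto simp: k_def fa)
    have "finv k \<circ> f \<in> rst {c<..<a n}"
    proof (rule rstI)
      fix x assume x: "x \<notin> {c<..<a n}"
      show "(finv k \<circ> f) x = x"
      proof (cases "a n \<le> x")
        case True
        then show ?thesis using ko by (simp add: aut_inv_eq_iff k_def)
      next
        case False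
        then have "f x = x" using x rstD(2)[OF f, of x] by auto
        then show ?thesis using False ko by (simp add: aut_inv_eq_iff k_def)
      qed
    qed (use ko fo in auto)
    then have "finv k \<circ> f \<in> H" using c by blast
    then have "k \<circ> (finv k \<circ> f) \<in> H" using kH small_indexD(2)[OF H] by blast
    moreover have "k \<circ> (finv k \<circ> f) = f" using ko by (simp add: fun_eq_iff)
    ultimately show ?thesis by simp
  qed
  \<comment> \<open>Every \<open>g\<close> factors as \<open>h \<circ> (finv h \<circ> g)\<close>, where both factors fix a ladder.\<close>
  have "rst {c<..} \<subseteq> H"
  proof
    fix g assume g: "g \<in> rst {c<..}"
    have go: "g \<in> order_auts" using rstD(1)[OF g] .
    \<comment> \<open>Both \<open>p x\<close> and \<open>g (p x)\<close> exceed \<open>x\<close>,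
      and \<open>A (Suc n)\<close> exceeds both for \<open>x = A n\<close>. Thus \<open>A\<close>
      interleaves with \<open>p \<circ> A\<close> and also with its image under
      \<open>g\<close>.\<close>
    define p where "p x = max x (finv g x) + 1" for x
    define A where "A = rec_nat c (\<lambda>_ x. max (p x) (g (p x)) + 1)"
    have A: "A 0 = c" "A (Suc n) = max (p (A n)) (g (p (A n))) + 1" for n by (simp_all add: A_def)
    have p: "x + 1 \<le> p x" "x < g (p x)" for x
    proof -
      have "finv g x < p x" by (auto simp: p_def max_def)
      then show "x < g (p x)" using aut_less_iff[OF go, of "finv g x" "p x"] go by simp
    qed (simp add: p_def)
    have AS: "p (A n) + 1 \<le> A (Suc n)" "g (p (A n)) + 1 \<le> A (Suc n)" for n by (simp_all add: A)
    have An: "of_nat n + c \<le> A n" for n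
    proof (induction n)
      case (Suc n)
      then show ?case using AS(1)[of n] p(1)[of "A n"] by simp
    qed (simp add: A)
    define \<alpha> where "\<alpha> j = (if even j then A (j div 2) else p (A (j div 2)))" for j
    define \<beta> where "\<beta> j = (if even j then A (j div 2) else g (p (A (j div 2))))" for j
    have lA: "ladder A"
    proof (rule ladderI[of _ "- c"])
      show "A n < A (Suc n)" for n using AS(1)[of n] p(1)[of "A n"] by linarith
      show "of_nat n \<le> A n + - c" for n using An[of n] by linarith
    qed
    have lp: "ladder (\<lambda>i. p (A i))"
    proof (rule ladderI[of _ "- c"])
      show "p (A n) < p (A (Suc n))" for n using AS(1)[of n] p(1)[of "A (Suc n)"] by linarith
      show "of_nat n \<le> p (A n) + - c" for n using An[of n] p(1)[of "A n"] by linarith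
    qed
    have interleave: "ladder (\<lambda>j. if even j then A (j div 2) else r (j div 2))"
      if r: "\<And>i. A i < r i" "\<And>i. r i < A (Suc i)" for r
      unfolding ladder_def
    proof (intro conjI allI)
      show "strict_mono (\<lambda>j. if even j then A (j div 2) else r (j div 2))"
        unfolding strict_mono_Suc_iff
      proof
        fix j
        show "(if even j then A (j div 2) else r (j div 2)) <
          (if even (Suc j) then A (Suc j div 2) else r (Suc j div 2))"
          using r[of "j div 2"] by (auto elim!: oddE evenE)
      qed
      fix y
      obtain n where "y < A n" using lA by (auto simp: ladder_def)
      then show "\<exists>n. y < (if even n then A (n div 2) else r (n div 2))"
        by (intro exI[of _ "2 * n"]) simp
    qed
    have l\<alpha>: "ladder \<alpha>"
      unfolding \<alpha>_def
    proof (rule interleave)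
      show "A i < p (A i)" "p (A i) < A (Suc i)" for i
        using p(1)[of "A i"] AS(1)[of i] by linarith+
    qed
    have l\<beta>: "ladder \<beta>"
      unfolding \<beta>_def
    proof (rule interleave)
      show "A i < g (p (A i))" "g (p (A i)) < A (Suc i)" for i
        using p(2)[of "A i"] AS(2)[of i] by linarith+
    qed
    \<comment> \<open>The transport \<open>h\<close> fixes the ladder \<open>A\<close> and agrees
      with \<open>g\<close> on \<open>p \<circ> A\<close>, so \<open>finv h \<circ> g\<close> fixes
      the latter.\<close>
    have "\<alpha> 0 = c" "\<beta> 0 = c" by (simp_all add: \<alpha>_def \<beta>_def A)
    then obtain h where h: "h \<in> rst {c<..}" and h\<alpha>: "\<And>j. h (\<alpha> j) = \<beta> j"
      using ladder_transport[OF l\<alpha> l\<beta>] by metis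
    have ho: "h \<in> order_auts" using rstD(1)[OF h] .
    have hA: "h (A i) = A i" for i using h\<alpha>[of "2 * i"] by (simp add: \<alpha>_def \<beta>_def)
    have hp: "h (p (A i)) = g (p (A i))" for i
      using h\<alpha>[of "2 * i + 1"] by (simp add: \<alpha>_def \<beta>_def)
    have "h \<in> H" by (rule step[OF h lA hA])
    moreover have "finv h \<circ> g \<in> H"
    proof (rule step[OF _ lp])
      show "finv h \<circ> g \<in> rst {c<..}" by (intro rst_comp rst_inv h g)
      show "(finv h \<circ> g) (p (A i)) = p (A i)" for i
        using ho hp[of i] by (simp add: aut_inv_eq_iff)
    qed
    ultimately have "h \<circ> (finv h \<circ> g) \<in> H" using small_indexD(2)[OF H] by blast
    moreover have "h \<circ> (finv h \<circ> g) = g" using ho by (simp add: fun_eq_iff)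
    ultimately show "g \<in> H" by simp
  qed
  then show thesis by (rule that)
qed

section \<open>Fixed points of subgroups of countable index\<close>

lemma finv_uminus: "finv uminus = (uminus :: rat \<Rightarrow> rat)"
  by (rule inv_unique_comp) auto

lemma reverse_auts:
  fixes f :: "rat \<Rightarrow> rat"
  assumes "f \<in> order_auts"
  shows "uminus \<circ> f \<circ> uminus \<in> order_auts"
proof (rule order_autsI)
  show "surj (uminus \<circ> f \<circ> uminus)"
    by (rule surjI[of _ "uminus \<circ> finv f \<circ> uminus"]) (use assms in simp)
qed (use assms in simp)

text \<open>Reflection at 0 reduces this to \<open>small_index_above\<close>.\<close>

lemma small_index_below:
  assumes H: "small_index H"
  obtains c :: rat where "rst {..<c} \<subseteq> H"
proof -
  have "small_index {f. uminus \<circ> f \<circ> finv uminus \<in> H}"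
    by (rule small_index_conj[OF H bij_uminus]) (simp_all add: finv_uminus reverse_auts)
  then obtain c :: rat where c: "rst {c<..} \<subseteq> {f. uminus \<circ> f \<circ> finv uminus \<in> H}"
    by (rule small_index_above) (rule that)
  have "rst {..<- c} \<subseteq> H"
  proof
    fix f assume f: "f \<in> rst {..<- c}"
    have "uminus \<circ> f \<circ> uminus \<in> rst {c<..}"
      using rstD[OF f] by (intro rstI reverse_auts) auto
    then have "uminus \<circ> (uminus \<circ> f \<circ> uminus) \<circ> uminus \<in> H" using c by (auto simp: finv_uminus)
    moreover have "uminus \<circ> (uminus \<circ> f \<circ> uminus) \<circ> uminus = f" by (simp add: fun_eq_iff)
    ultimately show "f \<in> H" by simp
  qed
  then show thesis by (rule that)
qed

section \<open>Irrational Dedekind cuts\<close>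

definition open_cut :: "rat set \<Rightarrow> bool" where
  "open_cut D \<longleftrightarrow> D \<noteq> {} \<and> - D \<noteq> {} \<and> (\<forall>x\<in>D. \<forall>y\<le>x. y \<in> D) \<and>
    (\<forall>x\<in>D. \<exists>y\<in>D. x < y) \<and> (\<forall>x. x \<notin> D \<longrightarrow> (\<exists>y. y \<notin> D \<and> y < x))"

text \<open>A strictly increasing sequence cofinal in \<open>D\<close> is interpolated by
  \<open>pl\<close>.\<close>

lemma open_cut_lower:
  assumes D: "open_cut D"
  shows "\<exists>f :: rat \<Rightarrow> rat. strict_mono f \<and> range f = D"
proof -
  obtain d where d: "d \<in> D" using D by (auto simp: open_cut_def)
  have down: "\<And>x y. x \<in> D \<Longrightarrow> y \<le> x \<Longrightarrow> y \<in> D" using D by (auto simp: open_cut_def)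
  obtain r :: "nat \<Rightarrow> rat" where r: "surj r" using surj_from_nat by blast
  \<comment> \<open>The recursion step: stay in \<open>D\<close>, increase, and pass the
    \<open>n\<close>-th rational if it lies in \<open>D\<close>. This forces cofinality.\<close>
  have "\<forall>n x. \<exists>y. x \<in> D \<longrightarrow> y \<in> D \<and> x < y \<and> (r n \<in> D \<longrightarrow> r n < y)"
  proof (intro allI)
    fix n x
    have "\<exists>y\<in>D. max x (r n) < y" if "x \<in> D" "r n \<in> D"
      using D that by (simp add: open_cut_def max_def)
    moreover have "\<exists>y\<in>D. x < y" if "x \<in> D" using D that by (simp add: open_cut_def)
    ultimately show "\<exists>y. x \<in> D \<longrightarrow> y \<in> D \<and> x < y \<and> (r n \<in> D \<longrightarrow> r n < y)" by force
  qed
  then obtain F where F: "\<And>n x. x \<in> D \<Longrightarrow> F n x \<in> D \<and> x < F n x \<and> (r n \<in> D \<longrightarrow> r n < F n x)"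
    by metis
  define a where "a = rec_nat d F"
  have aS: "a 0 = d" "a (Suc n) = F n (a n)" for n by (simp_all add: a_def)
  have aD: "a n \<in> D" for n by (induction n) (simp_all add: aS d F)
  have mono: "strict_mono a" using F aD by (simp add: strict_mono_Suc_iff aS)
  have "{y. \<exists>n. y < a n} = D"
  proof (intro equalityI subsetI)
    fix y assume y: "y \<in> D"
    obtain n where "r n = y" using r by (metis surjD)
    then have "y < a (Suc n)" using F[OF aD, of n n] y by (simp add: aS)
    then show "y \<in> {y. \<exists>n. y < a n}" by blast
  qed (use aD down less_imp_le in blast)
  then have "range (pl a) = D" using range_pl[OF mono] by simp
  moreover have "strict_mono (pl a)" using pl_less[OF mono] by (simp add: strict_mono_def)
  ultimately show ?thesis by blast
qed

text \<open>Reflection at 0 turns the complement into the lower half of another such cut.\<close>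

lemma open_cut_upper:
  assumes D: "open_cut D"
  shows "\<exists>f :: rat \<Rightarrow> rat. strict_mono f \<and> range f = - D"
proof -
  have "open_cut {x. - x \<notin> D}"
    unfolding open_cut_def
  proof (intro conjI ballI allI impI)
    obtain x y where "x \<in> D" "y \<notin> D" using D by (auto simp: open_cut_def)
    then have "- x \<notin> {x. - x \<notin> D}" "- y \<in> {x. - x \<notin> D}" by simp_all
    then show "{x. - x \<notin> D} \<noteq> {}" "- {x. - x \<notin> D} \<noteq> {}" by blast+
  next
    fix x y assume "x \<in> {x. - x \<notin> D}" "y \<le> x"
    moreover have "- x \<in> D" if "- y \<in> D" "- x \<le> - y" using that D by (auto simp: open_cut_def)
    ultimately show "y \<in> {x. - x \<notin> D}" by auto
  next
    fix x assume "x \<in> {x. - x \<notin> D}"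
    then have "- x \<notin> D" by simp
    then obtain y where "y \<notin> D" "y < - x" using D unfolding open_cut_def by blast
    then show "\<exists>y\<in>{x. - x \<notin> D}. x < y" by (intro bexI[of _ "- y"]) auto
  next
    fix x assume "x \<notin> {x. - x \<notin> D}"
    then have "- x \<in> D" by simp
    then obtain y where "y \<in> D" "- x < y" using D unfolding open_cut_def by blast
    then show "\<exists>y. y \<notin> {x. - x \<notin> D} \<and> y < x" by (intro exI[of _ "- y"]) auto
  qed
  from open_cut_lower[OF this] obtain f :: "rat \<Rightarrow> rat"
    where f: "strict_mono f" "range f = {x. - x \<notin> D}"
    by blast
  have "x \<in> range (\<lambda>x. - f (- x)) \<longleftrightarrow> x \<notin> D" for x
  proof
    assume "x \<notin> D"
    then have "- x \<in> range f" using f(2) by simp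
    then obtain z where "- x = f z" by blast
    then have "x = - f (- (- z))" by simp
    then show "x \<in> range (\<lambda>x. - f (- x))" by blast
  next
    assume "x \<in> range (\<lambda>x. - f (- x))"
    then obtain z where z: "x = - f (- z)" by blast
    have "f (- z) \<in> {x. - x \<notin> D}" using f(2) by blast
    then show "x \<notin> D" using z by simp
  qed
  then have "range (\<lambda>x. - f (- x)) = - D" by blast
  moreover have "strict_mono (\<lambda>x. - f (- x))" using f(1) by (simp add: strict_mono_def)
  ultimately show ?thesis by blast
qed

text \<open>Each half of each cut is a copy of the rationals, so lower and upper halves can be
  matched separately.\<close>

lemma open_cut_transport:
  assumes D: "open_cut D" and E: "open_cut E"
  obtains g where "g \<in> order_auts" "\<And>x. g x \<in> E \<longleftrightarrow> x \<in> D"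
proof -
  obtain fD :: "rat \<Rightarrow> rat" where fD: "strict_mono fD" "range fD = D"
    using open_cut_lower[OF D] by blast
  obtain fE :: "rat \<Rightarrow> rat" where fE: "strict_mono fE" "range fE = E"
    using open_cut_lower[OF E] by blast
  obtain uD :: "rat \<Rightarrow> rat" where uD: "strict_mono uD" "range uD = - D"
    using open_cut_upper[OF D] by blast
  obtain uE :: "rat \<Rightarrow> rat" where uE: "strict_mono uE" "range uE = - E"
    using open_cut_upper[OF E] by blast
  define g where "g x = (if x \<in> D then fE (finv fD x) else uE (finv uD x))" for x
  have fEin: "fE i \<in> E" and uEin: "uE i \<notin> E" and fDin: "fD i \<in> D" and uDin: "uD i \<notin> D" for i
    using fE(2) uE(2) fD(2) uD(2) by blast+
  have gf: "g (fD i) = fE i" and gu: "g (uD i) = uE i" for i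
    using fDin uDin strict_mono_imp_inj_on[OF fD(1)] strict_mono_imp_inj_on[OF uD(1)]
    by (simp_all add: g_def)
  have gE: "g x \<in> E \<longleftrightarrow> x \<in> D" for x using fEin uEin by (simp add: g_def)
  have "g \<in> order_auts"
  proof (rule order_autsI)
    show "surj g"
      unfolding surj_def
    proof
      fix y
      show "\<exists>x. y = g x"
      proof (cases "y \<in> E")
        case True
        then show ?thesis using fE(2) gf by (metis rangeE)
      next
        case False
        then have "y \<in> range uE" using uE(2) by blast
        then show ?thesis using gu by (metis rangeE)
      qed
    qed
    fix x y :: rat assume xy: "x < y"
    have down: "\<And>A x y. open_cut A \<Longrightarrow> x \<in> A \<Longrightarrow> y \<le> x \<Longrightarrow> y \<in> A" by (auto simp: open_cut_def)
    consider "x \<in> D" "y \<in> D" | "x \<in> D" "y \<notin> D" | "x \<notin> D" "y \<notin> D"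
      using down[OF D, of y x] xy by force
    then show "g x < g y"
    proof cases
      case 1
      then obtain i j where ij: "x = fD i" "y = fD j" using fD(2) by (metis rangeE)
      then have "i < j" using xy fD(1) by (simp add: strict_mono_less)
      then show ?thesis using ij gf fE(1) by (simp add: strict_monoD)
    next
      case 2
      then have "g x \<in> E" "g y \<notin> E" using gE by simp_all
      then show ?thesis using down[OF E, of "g x" "g y"] by force
    next
      case 3
      then have "x \<in> range uD" "y \<in> range uD" using uD(2) by simp_all
      then obtain i j where ij: "x = uD i" "y = uD j" by blast
      then have "i < j" using xy uD(1) by (simp add: strict_mono_less)
      then show ?thesis using ij gu uE(1) by (simp add: strict_monoD)
    qed
  qed
  then show thesis using gE by (rule that)
qed

lemma open_cut_irrational:
  fixes e :: real
  assumes "e \<notin> \<rat>"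
  shows "open_cut {x. of_rat x < e}"
proof -
  have ne: "of_rat x \<noteq> e" for x using assms by (metis Rats_of_rat)
  show ?thesis
    unfolding open_cut_def
  proof (intro conjI ballI allI impI)
    obtain x where "of_rat x < e" using of_rat_dense[of "e - 1" e] by auto
    then show "{x. of_rat x < e} \<noteq> {}" by blast
    obtain y where "e < of_rat y" using of_rat_dense[of e "e + 1"] by auto
    then have "y \<in> - {x. of_rat x < e}" by simp
    then show "- {x. of_rat x < e} \<noteq> {}" by blast
  next
    fix x y :: rat assume "x \<in> {x. of_rat x < e}" "y \<le> x"
    then show "y \<in> {x. of_rat x < e}" by (simp add: le_less_trans[of _ "of_rat x"] of_rat_less_eq)
  next
    fix x assume "x \<in> {x. of_rat x < e}"
    then show "\<exists>y\<in>{x. of_rat x < e}. x < y" using of_rat_dense[of "of_rat x" e] by (auto simp: of_rat_less)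
  next
    fix x assume "x \<notin> {x. of_rat x < e}"
    then have "e < of_rat x" using ne[of x] by simp
    then obtain y where "e < of_rat y" "of_rat y < (of_rat x :: real)" using of_rat_dense by blast
    then show "\<exists>y. y \<notin> {x. of_rat x < e} \<and> y < x"
      by (intro exI[of _ y]) (simp add: of_rat_less)
  qed
qed

text \<open>\<open>D\<close> can be carried to the cut at each of uncountably many irrationals. Two
  of these transports share a left coset of \<open>H\<close>, and their quotient does not preserve
  \<open>D\<close>.\<close>

lemma small_index_moves_open_cut:
  assumes H: "small_index H" and D: "open_cut D"
  obtains h x where "h \<in> H" "h x \<in> D \<longleftrightarrow> x \<notin> D"
proof -
  define E where "E e = {x :: rat. of_rat x < e}" for e :: real
  have "\<exists>g. g \<in> order_auts \<and> (\<forall>x. g x \<in> E e \<longleftrightarrow> x \<in> D)" if "e \<in> - \<rat>" for e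
    using open_cut_transport[OF D open_cut_irrational] that unfolding E_def by (metis Compl_iff)
  then obtain g where g: "\<And>e. e \<in> - \<rat> \<Longrightarrow> g e \<in> order_auts"
    and gE: "\<And>e x. e \<in> - \<rat> \<Longrightarrow> g e x \<in> E e \<longleftrightarrow> x \<in> D"
    by metis
  have unc: "uncountable (- \<rat> :: real set)"
    using uncountable_minus_countable[OF uncountable_UNIV_real countable_rat] by (simp add: Compl_eq_Diff_UNIV)
  obtain s t where st: "s \<in> - \<rat>" "t \<in> - \<rat>" "s \<noteq> t" and h: "finv (g s) \<circ> g t \<in> H"
    by (rule small_index_pigeonhole[OF H unc g]) (assumption, rule that)
  have "E s \<noteq> E t"
  proof
    assume eq: "E s = E t"
    have no: False if "e < e'" "E e = E e'" for e e'
    proof -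
      obtain q where "e < of_rat q" "of_rat q < e'" using of_rat_dense[OF \<open>e < e'\<close>] by blast
      then have "q \<in> E e'" "q \<notin> E e" by (auto simp: E_def)
      then show False using that(2) by simp
    qed
    show False using no[of s t] no[of t s] eq \<open>s \<noteq> t\<close> by (metis linorder_neqE_linordered_idom)
  qed
  then obtain y where y: "y \<in> E s \<longleftrightarrow> y \<notin> E t" by blast
  define x where "x = finv (g t) y"
  have gx: "g t x = y" using g[OF st(2)] by (simp add: x_def)
  have "(finv (g s) \<circ> g t) x \<in> D \<longleftrightarrow> y \<in> E s"
    using gE[OF st(1), of "finv (g s) y"] g[OF st(1)] gx by simp
  moreover have "x \<in> D \<longleftrightarrow> y \<in> E t" using gE[OF st(2), of x] gx by simp
  ultimately show thesis using that[OF h, of x] y by blast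
qed

text \<open>The set \<open>D\<close> of all \<open>b\<close> with \<open>rst {..<b} \<subseteq> H\<close> is a lower set invariant under \<open>H\<close>, so \<open>H\<close>
  fixes its boundary.\<close>

theorem small_index_fixes_point:
  assumes H: "small_index H" and proper: "H \<noteq> order_auts"
  obtains q :: rat where "\<And>h. h \<in> H \<Longrightarrow> h q = q"
proof -
  define D where "D = {b. rst {..<b} \<subseteq> H}"
  have sub: "H \<subseteq> order_auts" using small_indexD(1)[OF H] by blast
  have inv1: "h b \<in> D" if h: "h \<in> H" and b: "b \<in> D" for h b
  proof -
    have "rst {..<h b} \<subseteq> H"
    proof
      fix f assume f: "f \<in> rst {..<h b}"
      have ho: "h \<in> order_auts" using h sub by blast
      have h': "finv h \<in> H" using small_indexD(3)[OF H h] .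
      have "finv h \<circ> f \<circ> finv (finv h) \<in> rst {..<b}"
      proof (rule rst_conj[OF f])
        fix x assume "x \<in> {..<h b}"
        then show "finv h x \<in> {..<b}" using aut_less_iff[OF ho, of "finv h x" b] ho by simp
      qed (use ho in blast)
      then have "finv h \<circ> f \<circ> finv (finv h) \<in> H" using b by (auto simp: D_def)
      then show "f \<in> H" by (rule small_index_conj_mem[OF H h' rstD(1)[OF f]])
    qed
    then show ?thesis by (simp add: D_def)
  qed
  have inv: "h b \<in> D \<longleftrightarrow> b \<in> D" if h: "h \<in> H" for h b
    using inv1[OF h, of b] inv1[OF small_indexD(3)[OF H h], of "h b"] sub h by auto
  have down: "y \<in> D" if "x \<in> D" "y \<le> x" for x y
  proof -
    have "{..<y} \<subseteq> {..<x}" using that(2) by auto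
    then show ?thesis using that(1) rst_mono unfolding D_def by blast
  qed
  have fixes_max: "h d = d" if h: "h \<in> H" and d: "d \<in> D" and max: "\<And>b. b \<in> D \<Longrightarrow> b \<le> d" for h d
  proof -
    have "h d \<le> d" "finv h d \<le> d" using max inv1 h d small_indexD(3)[OF H h] by blast+
    moreover have "h (finv h d) \<le> h d" using calculation(2) aut_le_iff h sub by blast
    ultimately show ?thesis using h sub by auto
  qed
  have fixes_min: "h d = d" if h: "h \<in> H" and d: "d \<notin> D" and min: "\<And>b. b \<notin> D \<Longrightarrow> d \<le> b" for h d
  proof -
    have "d \<le> h d" "d \<le> finv h d" using min inv h d small_indexD(3)[OF H h] by blast+
    moreover have "h d \<le> h (finv h d)" using calculation(2) aut_le_iff h sub by blast
    ultimately show ?thesis using h sub by auto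
  qed
  obtain b where "rst {..<b} \<subseteq> H" by (rule small_index_below[OF H]) (rule that)
  then have ne: "D \<noteq> {}" by (auto simp: D_def)
  \<comment> \<open>Otherwise \<open>H\<close> contains every \<open>rst {..<b}\<close> and some
    \<open>rst {c<..}\<close>. These generate the group: \<open>g\<close> is corrected by some
    \<open>v\<close> so as to fix a point \<open>p\<close> above \<open>c\<close>, and the result is
    cut at \<open>p\<close>.\<close>
  have "- D \<noteq> {}"
  proof
    assume "- D = {}"
    then have D: "rst {..<b} \<subseteq> H" for b by (auto simp: D_def)
    obtain c where c: "rst {c<..} \<subseteq> H" by (rule small_index_above[OF H]) (rule that)
    have "order_auts \<subseteq> H"
    proof
      fix g :: "rat \<Rightarrow> rat" assume g: "g \<in> order_auts"
      define p where "p = max c (finv g c) + 1"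
      have "finv g c < p" by (auto simp: p_def max_def)
      then have p: "c < p" "c < g p" using aut_less_iff[OF g, of "finv g c" p] g by (auto simp: p_def)
      \<comment> \<open>The ladder starts at \<open>c\<close> with next rung \<open>r\<close>, so
        transporting \<open>a p\<close> to \<open>a (g p)\<close> takes \<open>p\<close> to
        \<open>g p\<close> inside \<open>rst {c<..}\<close>.\<close>
      define a where "a r j = (if j = 0 then c else r + of_nat j - 1)" for r :: rat and j :: nat
      have lad: "ladder (a r)" if "c < r" for r
      proof (rule ladderI[of _ "\<bar>r\<bar> + \<bar>c\<bar> + 1"])
        show "a r j < a r (Suc j)" for j using that by (simp add: a_def)
        show "of_nat j \<le> a r j + (\<bar>r\<bar> + \<bar>c\<bar> + 1)" for j by (auto simp: a_def)
      qed
      have a0: "a r 0 = c" for r by (simp add: a_def)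
      obtain v where v: "v \<in> rst {c<..}" "\<And>j. v (a p j) = a (g p) j"
        using ladder_transport[OF lad[OF p(1)] lad[OF p(2)]] a0 by metis
      have vo: "v \<in> order_auts" using rstD(1)[OF v(1)] .
      have vp: "v p = g p" using v(2)[of 1] by (simp add: a_def)
      define k where "k = finv v \<circ> g"
      have ko: "k \<in> order_auts" unfolding k_def using vo g by blast
      have kp: "k p = p" using vo by (simp add: k_def aut_inv_eq_iff vp)
      define r where "r = (\<lambda>x. if x \<in> {p..} then k x else x)"
      have r: "r \<in> rst {p..}" unfolding r_def by (rule restrict_atLeast[OF ko kp])
      have ro: "r \<in> order_auts" using rstD(1)[OF r] .
      have "{p..} \<subseteq> {c<..}" using p(1) by auto
      then have rH: "r \<in> H" using r c rst_mono by blast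
      have "finv r \<circ> k \<in> rst {..<p}"
      proof (rule rstI)
        fix x assume "x \<notin> {..<p}"
        then show "(finv r \<circ> k) x = x" using ro by (simp add: aut_inv_eq_iff r_def)
      qed (use ro ko in blast)
      then have "finv r \<circ> k \<in> H" using D by blast
      then have "v \<circ> (r \<circ> (finv r \<circ> k)) \<in> H"
        using v(1) c rH small_indexD(2)[OF H] by blast
      moreover have "v \<circ> (r \<circ> (finv r \<circ> k)) = g" using vo ro by (simp add: fun_eq_iff k_def)
      ultimately show "g \<in> H" by simp
    qed
    then show False using proper sub by blast
  qed
  show thesis
  \<comment> \<open>A nonempty proper lower set that is not an irrational cut has a maximum, or its
    complement has a minimum; \<open>H\<close> fixes that point.\<close>
  proof (cases "open_cut D")
    case True
    then show ?thesis using small_index_moves_open_cut[OF H True] inv by metis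
  next
    case False
    then consider d where "d \<in> D" "\<And>b. b \<in> D \<Longrightarrow> b \<le> d"
      | d where "d \<notin> D" "\<And>b. b \<notin> D \<Longrightarrow> d \<le> b"
      using ne \<open>- D \<noteq> {}\<close> down unfolding open_cut_def by (metis not_le)
    then show ?thesis using fixes_max fixes_min that by cases blast+
  qed
qed

section \<open>Automorphisms are conjugations\<close>

lemma affine_auts:
  fixes a b :: rat
  assumes "0 < a"
  shows "(\<lambda>x. a * x + b) \<in> order_auts"
  by (rule order_autsI[OF surjI[of _ "\<lambda>x. (x - b) / a"]]) (use assms in auto)

lemma two_homogeneous:
  fixes p q p' q' :: rat
  assumes "p < q" "p' < q'"
  obtains g where "g \<in> order_auts" "g p = p'" "g q = q'"
proof (rule that)
  define a where "a = (q' - p') / (q - p)"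
  show "(\<lambda>x. a * x + (p' - a * p)) \<in> order_auts"
    by (rule affine_auts) (use assms in \<open>simp add: a_def\<close>)
  show "a * p + (p' - a * p) = p'" by simp
  have "a * (q - p) = q' - p'" using assms by (simp add: a_def)
  then show "a * q + (p' - a * p) = q'" by (simp add: algebra_simps)
qed

text \<open>The map doubling distances from \<open>q\<close>. It recovers a point from its
  stabiliser, and later a bijection from the conjugation by it.\<close>

lemma dilation:
  fixes q :: rat
  obtains g where "g \<in> order_auts" "\<And>x. g x = x \<longleftrightarrow> x = q"
  by (rule that[OF affine_auts[of 2 "- q"]]) auto

definition stab :: "'a::linorder \<Rightarrow> ('a \<Rightarrow> 'a) set" where
  "stab q = {f \<in> order_auts. f q = q}"

lemma stab_fixed_point:
  fixes q r :: rat
  assumes "\<And>f. f \<in> stab q \<Longrightarrow> f r = r"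
  shows "r = q"
proof -
  obtain g :: "rat \<Rightarrow> rat" where g: "g \<in> order_auts" "\<And>x. g x = x \<longleftrightarrow> x = q"
    by (rule dilation) (rule that)
  then show ?thesis using assms[of g] by (simp add: stab_def)
qed

text \<open>No condition is imposed off the carrier, so that the \<open>inv_into\<close> of such a
  map is of the same kind.\<close>

definition comp_aut :: "((rat \<Rightarrow> rat) \<Rightarrow> (rat \<Rightarrow> rat)) \<Rightarrow> bool" where
  "comp_aut \<phi> \<longleftrightarrow> bij_betw \<phi> order_auts order_auts \<and>
    (\<forall>f\<in>order_auts. \<forall>g\<in>order_auts. \<phi> (f \<circ> g) = \<phi> f \<circ> \<phi> g)"

lemma comp_autD:
  assumes "comp_aut \<phi>"
  shows "f \<in> order_auts \<Longrightarrow> \<phi> f \<in> order_auts"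
    "f \<in> order_auts \<Longrightarrow> g \<in> order_auts \<Longrightarrow> \<phi> (f \<circ> g) = \<phi> f \<circ> \<phi> g"
    "f \<in> order_auts \<Longrightarrow> \<phi> (finv f) = finv (\<phi> f)"
proof -
  show cl: "\<phi> f \<in> order_auts" if "f \<in> order_auts" for f
    using assms that by (auto simp: comp_aut_def dest: bij_betwE)
  show mu: "\<phi> (f \<circ> g) = \<phi> f \<circ> \<phi> g" if "f \<in> order_auts" "g \<in> order_auts" for f g
    using assms that by (auto simp: comp_aut_def)
  assume f: "f \<in> order_auts"
  have "\<phi> id = \<phi> id \<circ> \<phi> id" using mu[of id id] by simp
  then have "\<phi> id x = x" for x using aut_eq_iff[OF cl[OF aut_id], of "\<phi> id x" x] by (metis comp_apply)
  then have "\<phi> f (\<phi> (finv f) x) = x" for x using mu[OF f aut_inv[OF f]] f by (metis comp_apply aut_inv_comp(2))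
  then have "finv (\<phi> f) x = \<phi> (finv f) x" for x using cl[OF f] by (simp add: aut_inv_eq_iff)
  then show "\<phi> (finv f) = finv (\<phi> f)" by (simp add: fun_eq_iff)
qed

lemma comp_aut_inv_into:
  assumes \<phi>: "comp_aut \<phi>"
  defines "\<psi> \<equiv> inv_into order_auts \<phi>"
  shows "comp_aut \<psi>" "f \<in> order_auts \<Longrightarrow> \<psi> (\<phi> f) = f" "f \<in> order_auts \<Longrightarrow> \<phi> (\<psi> f) = f"
proof -
  have b: "bij_betw \<phi> order_auts order_auts" using \<phi> by (simp add: comp_aut_def)
  have b': "bij_betw \<psi> order_auts order_auts" unfolding \<psi>_def by (rule bij_betw_inv_into[OF b])
  show l: "\<psi> (\<phi> f) = f" if "f \<in> order_auts" for f
    using b that by (simp add: \<psi>_def bij_betw_inv_into_left)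
  show r: "\<phi> (\<psi> f) = f" if "f \<in> order_auts" for f
    using b that by (simp add: \<psi>_def bij_betw_inv_into_right)
  have cl: "\<psi> f \<in> order_auts" if "f \<in> order_auts" for f using b' that by (auto dest: bij_betwE)
  have "\<psi> (f \<circ> g) = \<psi> f \<circ> \<psi> g" if "f \<in> order_auts" "g \<in> order_auts" for f g
    using l[of "\<psi> f \<circ> \<psi> g"] comp_autD(2)[OF \<phi>, of "\<psi> f" "\<psi> g"] r cl that by simp
  then show "comp_aut \<psi>" using b' by (simp add: comp_aut_def)
qed

text \<open>Left cosets of \<open>stab q\<close> correspond to images of \<open>q\<close>, of which
  there are countably many; \<open>\<psi>\<close> transfers this colouring to the image. The image
  is proper because a translation moves \<open>q\<close>.\<close>

lemma comp_aut_stab_fixes: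
  assumes \<phi>: "comp_aut \<phi>"
  shows "\<exists>r. \<forall>f\<in>stab q. \<phi> f r = r"
proof -
  define \<psi> where "\<psi> = inv_into order_auts \<phi>"
  note \<psi> = comp_aut_inv_into[OF \<phi>, folded \<psi>_def]
  have "small_index (\<phi> ` stab q)"
    unfolding small_index_def
  proof (intro conjI ballI exI[of _ "\<lambda>f. to_nat (\<psi> f q)"] impI)
    show "\<phi> ` stab q \<subseteq> order_auts" using comp_autD(1)[OF \<phi>] by (auto simp: stab_def)
    show "f \<circ> g \<in> \<phi> ` stab q" if fg: "f \<in> \<phi> ` stab q" "g \<in> \<phi> ` stab q" for f g
    proof -
      obtain u v where "f = \<phi> u" "g = \<phi> v" and uv: "u \<in> stab q" "v \<in> stab q" using fg by blast
      then have "f \<circ> g = \<phi> (u \<circ> v)" using comp_autD(2)[OF \<phi>] by (simp add: stab_def)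
      moreover have "u \<circ> v \<in> stab q" using uv by (auto simp: stab_def)
      ultimately show ?thesis by blast
    qed
    show "finv f \<in> \<phi> ` stab q" if f: "f \<in> \<phi> ` stab q" for f
    proof -
      obtain u where "f = \<phi> u" and u: "u \<in> stab q" using f by blast
      then have "finv f = \<phi> (finv u)" using comp_autD(3)[OF \<phi>] by (simp add: stab_def)
      moreover have "finv u \<in> stab q" using u by (auto simp: stab_def aut_inv_eq_iff)
      ultimately show ?thesis by blast
    qed
    show "finv f \<circ> g \<in> \<phi> ` stab q"
      if "f \<in> order_auts" "g \<in> order_auts" "to_nat (\<psi> f q) = to_nat (\<psi> g q)" for f g
    proof -
      have a: "\<psi> f \<in> order_auts" "\<psi> g \<in> order_auts" using that comp_autD(1)[OF \<psi>(1)] by blast+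
      have "finv (\<psi> f) \<circ> \<psi> g \<in> stab q" using a that(3) by (auto simp: stab_def aut_inv_eq_iff)
      moreover have "\<phi> (finv (\<psi> f) \<circ> \<psi> g) = finv f \<circ> g"
        using comp_autD(2,3)[OF \<phi>] a \<psi>(3) that by simp
      ultimately show ?thesis by (metis image_eqI)
    qed
  qed
  moreover have "\<phi> ` stab q \<noteq> order_auts"
  proof
    assume eq: "\<phi> ` stab q = order_auts"
    have t: "(\<lambda>x. 1 * x + 1 :: rat) \<in> order_auts" by (rule affine_auts) simp
    then have "\<phi> (\<lambda>x. 1 * x + 1) \<in> \<phi> ` stab q" using eq comp_autD(1)[OF \<phi>] by blast
    then obtain u where u: "u \<in> stab q" "\<phi> (\<lambda>x. 1 * x + 1) = \<phi> u" by blast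
    then have "u = (\<lambda>x. 1 * x + 1)" using \<psi>(2) t by (metis (no_types, lifting) mem_Collect_eq stab_def)
    then show False using u(1) by (simp add: stab_def)
  qed
  ultimately obtain r where "\<And>h. h \<in> \<phi> ` stab q \<Longrightarrow> h r = r"
    by (rule small_index_fixes_point) (rule that)
  then show ?thesis by blast
qed

theorem comp_aut_conj:
  assumes \<phi>: "comp_aut \<phi>"
  obtains \<sigma> where "bij \<sigma>" "(\<forall>x y. x < y \<longrightarrow> \<sigma> x < \<sigma> y) \<or> (\<forall>x y. x < y \<longrightarrow> \<sigma> y < \<sigma> x)"
    "\<And>f x. f \<in> order_auts \<Longrightarrow> \<phi> f (\<sigma> x) = \<sigma> (f x)"
proof -
  define \<psi> where "\<psi> = inv_into order_auts \<phi>"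
  note \<psi> = comp_aut_inv_into[OF \<phi>, folded \<psi>_def]
  obtain \<sigma> where \<sigma>: "\<And>q f. f \<in> stab q \<Longrightarrow> \<phi> f (\<sigma> q) = \<sigma> q"
    using comp_aut_stab_fixes[OF \<phi>] by metis
  obtain \<tau> where \<tau>: "\<And>q f. f \<in> stab q \<Longrightarrow> \<psi> f (\<tau> q) = \<tau> q"
    using comp_aut_stab_fixes[OF \<psi>(1)] by metis
  have stab_auts: "f \<in> order_auts" if "f \<in> stab q" for f and q :: rat using that by (simp add: stab_def)
  \<comment> \<open>Applying \<open>\<psi>\<close> shows that all of \<open>stab q\<close> fixes
    \<open>\<tau> r\<close>, but \<open>q\<close> is its only fixed point. Hence the choices
    \<open>\<sigma>\<close> and \<open>\<tau>\<close> are mutually inverse.\<close>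
  have unique: "\<tau> r = q" if r: "\<And>f. f \<in> stab q \<Longrightarrow> \<phi> f r = r" for q r
  proof (rule stab_fixed_point)
    fix f assume f: "f \<in> stab q"
    then have "\<phi> f \<in> stab r" using r comp_autD(1)[OF \<phi> stab_auts[OF f]] by (simp add: stab_def)
    then show "f (\<tau> r) = \<tau> r" using \<tau> \<psi>(2)[OF stab_auts[OF f]] by metis
  qed
  have unique': "\<sigma> r = q" if r: "\<And>f. f \<in> stab q \<Longrightarrow> \<psi> f r = r" for q r
  proof (rule stab_fixed_point)
    fix f assume f: "f \<in> stab q"
    then have "\<psi> f \<in> stab r" using r comp_autD(1)[OF \<psi>(1) stab_auts[OF f]] by (simp add: stab_def)
    then show "f (\<sigma> r) = \<sigma> r" using \<sigma> \<psi>(3)[OF stab_auts[OF f]] by metis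
  qed
  have inv1: "\<tau> (\<sigma> q) = q" and inv2: "\<sigma> (\<tau> q) = q" for q
    using unique \<sigma> unique' \<tau> by blast+
  have bij: "bij \<sigma>" by (rule o_bij[of \<tau>]) (simp_all add: fun_eq_iff inv1 inv2)
  \<comment> \<open>If \<open>h\<close> fixes \<open>f x\<close>, then
    \<open>finv f \<circ> h \<circ> f\<close> fixes \<open>x\<close>; so
    \<open>\<phi> f (\<sigma> x)\<close> is fixed by the image of \<open>stab (f x)\<close>, which
    determines it.\<close>
  have eq: "\<phi> f (\<sigma> x) = \<sigma> (f x)" if f: "f \<in> order_auts" for f x
  proof -
    have "\<tau> (\<phi> f (\<sigma> x)) = f x"
    proof (rule unique)
      fix h assume h: "h \<in> stab (f x)"
      have ho: "h \<in> order_auts" using h stab_auts by blast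
      have "finv f \<circ> (h \<circ> f) \<in> stab x" using h f by (auto simp: stab_def aut_inv_eq_iff)
      then have "\<phi> (finv f \<circ> (h \<circ> f)) (\<sigma> x) = \<sigma> x" by (rule \<sigma>)
      moreover have "\<phi> (finv f \<circ> (h \<circ> f)) = finv (\<phi> f) \<circ> (\<phi> h \<circ> \<phi> f)"
        using comp_autD(2,3)[OF \<phi>] f ho by simp
      ultimately show "\<phi> h (\<phi> f (\<sigma> x)) = \<phi> f (\<sigma> x)"
        using comp_autD(1)[OF \<phi> f] by (simp add: aut_inv_eq_iff)
    qed
    then show ?thesis using inv2 by metis
  qed
  \<comment> \<open>Any increasing pair can be carried to any other, so comparing
    \<open>\<sigma> 0\<close> with \<open>\<sigma> 1\<close> decides the direction
    everywhere.\<close>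
  have move: "\<exists>f\<in>order_auts. \<sigma> p' = f (\<sigma> p) \<and> \<sigma> q' = f (\<sigma> q)" if lt: "p < q" "p' < q'" for p q p' q'
  proof -
    obtain g where g: "g \<in> order_auts" "g p = p'" "g q = q'"
      by (rule two_homogeneous[OF lt]) (rule that)
    then show ?thesis using eq[OF g(1)] comp_autD(1)[OF \<phi> g(1)] by metis
  qed
  have ne: "\<sigma> 0 \<noteq> \<sigma> 1" using inv1[of 0] inv1[of 1] by auto
  have "(\<forall>x y. x < y \<longrightarrow> \<sigma> x < \<sigma> y) \<or> (\<forall>x y. x < y \<longrightarrow> \<sigma> y < \<sigma> x)"
  proof (cases "\<sigma> 0 < \<sigma> 1")
    case True
    have "\<sigma> x < \<sigma> y" if "x < y" for x y
      using move[of 0 1, OF zero_less_one that] True by auto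
    then show ?thesis by blast
  next
    case False
    then have "\<sigma> 1 < \<sigma> 0" using ne by simp
    then have "\<sigma> y < \<sigma> x" if "x < y" for x y
      using move[of 0 1, OF zero_less_one that] by auto
    then show ?thesis by blast
  qed
  then show thesis using that bij eq by blast
qed

section \<open>Conjugation by monotone and antitone bijections\<close>

definition twist :: "(rat \<Rightarrow> rat) \<times> int \<Rightarrow> rat \<Rightarrow> rat" where
  "twist p = (if snd p = 0 then fst p else fst p \<circ> uminus)"

text \<open>Restricted to the carrier because elements of \<open>auto\<close> are
  extensional.\<close>

definition conj_by :: "(rat \<Rightarrow> rat) \<Rightarrow> (rat \<Rightarrow> rat) \<Rightarrow> rat \<Rightarrow> rat" where
  "conj_by w = (\<lambda>f \<in> order_auts. w \<circ> f \<circ> finv w)"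

lemma twist_surj:
  assumes w: "bij w" "(\<forall>x y. x < y \<longrightarrow> w x < w y) \<or> (\<forall>x y. x < y \<longrightarrow> w y < w x)"
  obtains n i where "n \<in> order_auts" "i \<in> {0, 1}" "twist (n, i) = w"
  using w(2)
proof
  assume "\<forall>x y. x < y \<longrightarrow> w x < w y"
  then have "w \<in> order_auts" using w(1) by (intro order_autsI) (auto simp: bij_is_surj)
  then show thesis using that[of w 0] by (simp add: twist_def)
next
  assume "\<forall>x y. x < y \<longrightarrow> w y < w x"
  then have "w \<circ> uminus \<in> order_auts"
    by (intro order_autsI bij_is_surj[OF bij_comp[OF bij_uminus w(1)]]) simp
  moreover have "twist (w \<circ> uminus, 1) = w" by (simp add: twist_def fun_eq_iff)
  ultimately show thesis using that[of "w \<circ> uminus" 1] by simp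
qed

lemma twist_props:
  assumes n: "n \<in> order_auts"
  shows "bij (twist (n, i))"
    and "f \<in> order_auts \<Longrightarrow> twist (n, i) \<circ> f \<circ> finv (twist (n, i)) \<in> order_auts"
    and "f \<in> order_auts \<Longrightarrow> finv (twist (n, i)) \<circ> f \<circ> twist (n, i) \<in> order_auts"
proof -
  have i: "finv (n \<circ> uminus) = uminus \<circ> finv n"
    using n by (subst o_inv_distrib) (simp_all add: aut_bij finv_uminus bij_uminus)
  show "bij (twist (n, i))" using aut_bij[OF n] by (auto simp: twist_def intro: bij_comp bij_uminus)
  assume f: "f \<in> order_auts"
  have "n \<circ> (uminus \<circ> f \<circ> uminus) \<circ> finv n \<in> order_auts"
    by (rule aut_comp[OF aut_comp[OF n reverse_auts[OF f]] aut_inv[OF n]])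
  then show "twist (n, i) \<circ> f \<circ> finv (twist (n, i)) \<in> order_auts"
    using n f by (simp add: twist_def i comp_assoc)
  have "uminus \<circ> (finv n \<circ> f \<circ> n) \<circ> uminus \<in> order_auts"
    by (rule reverse_auts[OF aut_comp[OF aut_comp[OF aut_inv[OF n] f] n]])
  then show "finv (twist (n, i)) \<circ> f \<circ> twist (n, i) \<in> order_auts"
    using n f by (simp add: twist_def i comp_assoc)
qed

lemma conj_by_twist_auto:
  assumes n: "n \<in> order_auts"
  shows "conj_by (twist (n, i)) \<in> auto order_Aut"
proof -
  let ?w = "twist (n, i)"
  note w = twist_props[OF n, where i = i]
  have [simp]: "finv ?w (?w x) = x" "?w (finv ?w x) = x" for x
    using w(1) by (simp_all add: bij_is_inj bij_is_surj surj_f_inv_f)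
  have "bij_betw (conj_by ?w) order_auts order_auts"
    by (rule bij_betwI[where g = "\<lambda>f. finv ?w \<circ> f \<circ> ?w"])
      (auto simp: conj_by_def w(2,3) fun_eq_iff)
  then have "conj_by ?w \<in> Bij order_auts" by (simp add: Bij_def conj_by_def)
  moreover have "conj_by ?w \<in> hom order_Aut order_Aut"
  proof (rule homI)
    fix f g :: "rat \<Rightarrow> rat" assume fg: "f \<in> order_auts" "g \<in> order_auts"
    show "conj_by ?w f \<in> order_auts" using fg w(2) by (simp add: conj_by_def)
    have "conj_by ?w (f \<circ> g) = conj_by ?w f \<circ> conj_by ?w g"
      using fg by (simp add: conj_by_def fun_eq_iff)
    then show "conj_by ?w (f \<otimes>\<^bsub>order_Aut\<^esub> g) = conj_by ?w f \<otimes>\<^bsub>order_Aut\<^esub> conj_by ?w g"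
      using fg w(2) by (simp add: mult_order_Aut conj_by_def)
  qed
  ultimately show ?thesis by (simp add: auto_def)
qed

lemma conj_by_compose:
  assumes n: "n \<in> order_auts" "m \<in> order_auts"
  shows "conj_by (twist (n, i) \<circ> twist (m, j)) =
    compose order_auts (conj_by (twist (n, i))) (conj_by (twist (m, j)))"
proof
  fix f
  show "conj_by (twist (n, i) \<circ> twist (m, j)) f =
    compose order_auts (conj_by (twist (n, i))) (conj_by (twist (m, j))) f"
    using twist_props[OF n(1), where i = i] twist_props[OF n(2), where i = j]
    by (cases "f \<in> order_auts") (simp_all add: conj_by_def compose_def o_inv_distrib comp_assoc)
qed

text \<open>Conjugating the dilation at \<open>q\<close> by \<open>w\<close> gives a map whose only
  fixed point is \<open>w q\<close>, so the conjugation determines \<open>w\<close>.\<close>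

lemma conj_by_inj:
  assumes n: "n \<in> order_auts" "m \<in> order_auts"
    and eq: "conj_by (twist (n, i)) = conj_by (twist (m, j))"
  shows "twist (n, i) = twist (m, j)"
proof
  let ?w = "twist (n, i)" and ?v = "twist (m, j)"
  have b: "bij ?w" "bij ?v" using twist_props(1) n by blast+
  have vv: "?v (finv ?v x) = x" "finv ?v (?v x) = x" for x
    using b(2) by (simp_all add: bij_is_inj bij_is_surj surj_f_inv_f)
  have ww: "finv ?w (?w x) = x" for x using b(1) by (simp add: bij_is_inj)
  fix q
  obtain f :: "rat \<Rightarrow> rat" where f: "f \<in> order_auts" "\<And>x. f x = x \<longleftrightarrow> x = q"
    by (rule dilation) (rule that)
  have "?w \<circ> f \<circ> finv ?w = ?v \<circ> f \<circ> finv ?v"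
    using fun_cong[OF eq, of f] f(1) by (simp add: conj_by_def)
  then have "?w (f (finv ?w (?w q))) = ?v (f (finv ?v (?w q)))" by (metis comp_apply)
  then have "?w q = ?v (f (finv ?v (?w q)))" using ww f(2)[of q] by simp
  then have "f (finv ?v (?w q)) = finv ?v (?w q)" by (metis vv(2))
  then have "finv ?v (?w q) = q" using f(2) by blast
  then show "?w q = ?v q" using vv(1) by metis
qed

lemma twist_inj:
  assumes n: "n \<in> order_auts" "m \<in> order_auts" and ij: "i \<in> {0, 1}" "j \<in> {0, 1}"
    and eq: "twist (n, i) = twist (m, j)"
  shows "n = m \<and> i = j"
proof -
  have no: False if "u \<in> order_auts" "v \<in> order_auts" "u = v \<circ> uminus" for u v :: "rat \<Rightarrow> rat"
  proof -
    have "u 0 < u 1" using that(1) by simp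
    moreover have "v (- 1) < v 0" using that(2) by simp
    ultimately show False using that(3) by simp
  qed
  have cancel: "u = v" if "u \<circ> uminus = v \<circ> (uminus :: rat \<Rightarrow> rat)" for u v :: "rat \<Rightarrow> rat"
  proof
    fix x show "u x = v x" using fun_cong[OF that, of "- x"] by simp
  qed
  show ?thesis
    using ij eq no[OF n] no[OF n(2,1)] cancel[of n m] by (auto simp: twist_def)
qed

text \<open>The action lets \<open>uminus\<close> pass an automorphism:
  \<open>uminus \<circ> m = reversal_action 1 m \<circ> uminus\<close>. Two reversals cancel,
  matching addition modulo 2.\<close>

lemma twist_mult:
  assumes "p \<in> carrier (semidirect_product order_Aut (integer_mod_group 2) reversal_action)"
    "q \<in> carrier (semidirect_product order_Aut (integer_mod_group 2) reversal_action)"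
  shows "twist (p \<otimes>\<^bsub>semidirect_product order_Aut (integer_mod_group 2) reversal_action\<^esub> q) =
    twist p \<circ> twist q"
proof -
  obtain n i m j where pq: "p = (n, i)" "q = (m, j)" by (cases p, cases q)
  have c: "n \<in> order_auts" "m \<in> order_auts" "i \<in> {0, 1}" "j \<in> {0, 1}"
    using assms pq by (auto simp: semidirect_product_def carrier_integer_mod_group)
  have "reversal_action i m \<in> order_auts" using reverse_auts[OF c(2)] c by (simp add: reversal_action_def)
  then have "p \<otimes>\<^bsub>semidirect_product order_Aut (integer_mod_group 2) reversal_action\<^esub> q =
      (n \<circ> reversal_action i m, (i + j) mod 2)"
    using c by (simp add: semidirect_product_def pq mult_order_Aut)
  then show ?thesis
    using c by (auto simp: pq twist_def reversal_action_def fun_eq_iff)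
qed

lemma comp_aut_auto:
  assumes "\<phi> \<in> auto (order_Aut :: (rat \<Rightarrow> rat) monoid)"
  shows "comp_aut \<phi>"
proof -
  have b: "bij_betw \<phi> order_auts order_auts" and h: "\<phi> \<in> hom order_Aut order_Aut"
    using assms by (auto simp: auto_def Bij_def)
  have "\<phi> (f \<circ> g) = \<phi> f \<circ> \<phi> g" if "f \<in> order_auts" "g \<in> order_auts" for f g
    using hom_mult[OF h that] hom_in_carrier[OF h] that by (simp add: mult_order_Aut)
  then show ?thesis using b by (simp add: comp_aut_def)
qed

text \<open>The isomorphism is built in the opposite direction, sending \<open>p\<close> to
  conjugation by \<open>twist p\<close>. Injectivity comes from \<open>conj_by_inj\<close> and
  \<open>twist_inj\<close>, surjectivity from \<open>comp_aut_conj\<close> and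
  \<open>twist_surj\<close>.\<close>

theorem corollary1p6:
  shows "AutoGroup (order_Aut :: (rat \<Rightarrow> rat) monoid)
           \<cong> semidirect_product (order_Aut :: (rat \<Rightarrow> rat) monoid) (integer_mod_group 2) reversal_action"
proof -
  let ?P = "semidirect_product (order_Aut :: (rat \<Rightarrow> rat) monoid) (integer_mod_group 2) reversal_action"
  let ?\<Theta> = "\<lambda>p. conj_by (twist p)"
  have grp: "group ?P"
    by (rule group_semidirect_product[OF group_order_Aut group_integer_mod_group hom_reversal_action])
  have carr: "carrier ?P = order_auts \<times> {0, 1}"
    by (auto simp: semidirect_product_def carrier_integer_mod_group)
  have aut: "?\<Theta> p \<in> auto order_Aut" if "p \<in> carrier ?P" for p
    using that conj_by_twist_auto by (auto simp: carr)
  have "?\<Theta> \<in> hom ?P (AutoGroup order_Aut)"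
  proof (rule homI)
    fix p q assume pq: "p \<in> carrier ?P" "q \<in> carrier ?P"
    show "?\<Theta> p \<in> carrier (AutoGroup order_Aut)" using aut[OF pq(1)] by (simp add: AutoGroup_def)
    have "?\<Theta> (p \<otimes>\<^bsub>?P\<^esub> q) = compose order_auts (?\<Theta> p) (?\<Theta> q)"
      using pq conj_by_compose by (auto simp: twist_mult carr)
    moreover have "?\<Theta> p \<in> Bij order_auts" "?\<Theta> q \<in> Bij order_auts"
      using aut[OF pq(1)] aut[OF pq(2)] by (simp_all add: auto_def)
    ultimately show "?\<Theta> (p \<otimes>\<^bsub>?P\<^esub> q) = ?\<Theta> p \<otimes>\<^bsub>AutoGroup order_Aut\<^esub> ?\<Theta> q"
      by (simp add: AutoGroup_def BijGroup_def)
  qed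
  moreover have "bij_betw ?\<Theta> (carrier ?P) (carrier (AutoGroup order_Aut))"
    unfolding bij_betw_def
  proof
    show "inj_on ?\<Theta> (carrier ?P)"
    proof (rule inj_onI)
      fix p q assume pq: "p \<in> carrier ?P" "q \<in> carrier ?P" and eq: "?\<Theta> p = ?\<Theta> q"
      obtain n i m j where ni: "p = (n, i)" "q = (m, j)" by (cases p, cases q)
      then have c: "n \<in> order_auts" "m \<in> order_auts" "i \<in> {0, 1}" "j \<in> {0, 1}"
        using pq by (simp_all add: carr)
      show "p = q" using twist_inj[OF c conj_by_inj[OF c(1,2)]] eq by (simp add: ni)
    qed
    show "?\<Theta> ` carrier ?P = carrier (AutoGroup order_Aut)"
    proof (intro equalityI subsetI)
      fix \<phi> assume "\<phi> \<in> carrier (AutoGroup (order_Aut :: (rat \<Rightarrow> rat) monoid))"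
      then have \<phi>: "\<phi> \<in> auto order_Aut" by (simp add: AutoGroup_def)
      obtain \<sigma> where \<sigma>: "bij \<sigma>" "(\<forall>x y. x < y \<longrightarrow> \<sigma> x < \<sigma> y) \<or> (\<forall>x y. x < y \<longrightarrow> \<sigma> y < \<sigma> x)"
        and eq: "\<And>f x. f \<in> order_auts \<Longrightarrow> \<phi> f (\<sigma> x) = \<sigma> (f x)"
        using comp_aut_conj[OF comp_aut_auto[OF \<phi>]] by metis
      obtain n i where ni: "n \<in> order_auts" "i \<in> {0, 1}" "twist (n, i) = \<sigma>"
        using twist_surj[OF \<sigma>] by metis
      have "\<phi> f = conj_by \<sigma> f" for f
      proof (cases "f \<in> order_auts")
        case True
        have "\<phi> f x = (\<sigma> \<circ> f \<circ> finv \<sigma>) x" for x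
          using eq[OF True, of "finv \<sigma> x"] \<sigma>(1) by (simp add: bij_is_surj surj_f_inv_f)
        then show ?thesis using True by (simp add: conj_by_def fun_eq_iff)
      next
        case False
        \<comment> \<open>Off the carrier both maps take the value \<open>undefined\<close>.\<close>
        have "\<phi> \<in> extensional order_auts" using \<phi> by (simp add: auto_def Bij_def)
        then show ?thesis using False by (simp add: conj_by_def extensional_def)
      qed
      then have "\<phi> = ?\<Theta> (n, i)" using ni(3) by (intro ext) simp
      then show "\<phi> \<in> ?\<Theta> ` carrier ?P" using ni(1,2) by (auto simp: carr)
    qed (use aut in \<open>auto simp: AutoGroup_def\<close>)
  qed
  ultimately have "?\<Theta> \<in> iso ?P (AutoGroup order_Aut)" by (simp add: iso_def)
  then have "?P \<cong> AutoGroup (order_Aut :: (rat \<Rightarrow> rat) monoid)" by (rule is_isoI)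
  then show ?thesis by (rule group.iso_sym[OF grp])
qed

end
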